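(* Let $g$ be a Carmichael polynomial in $\mathbb{F}_q[t]$. Then $g$ is Carmichael in every finite Galois extension $K$ of $\mathbb{F}_q(t)$ whose discriminant is relatively prime to $g$.
   Context: $\mathbb{F}_q$ is the finite field with $q$ elements. A finite ring $S$ is a Carmichael ring if $S$ is not a field and $a^{|S|}=a$ for every $a\in S$; an ideal $I$ of a ring $R$ is a Carmichael ideal if $R/I$ is a Carmichael ring. A polynomial $g\in\mathbb{F}_q[t]$ is a Carmichael polynomial if $(g)$ is a Carmichael ideal of $\mathbb{F}_q[t]$. For a finite extension $K$ of $\mathbb{F}_q(t)$, $\mathcal{O}_K$ denotes the integral closure of $\mathbb{F}_q[t]$ in $K$, and an element $\alpha\in\mathcal{O}_K$ is Carmichael in $K$ if $\alpha\mathcal{O}_K$ is a Carmichael ideal of $\mathcal{O}_K$. The discriminant of $K$ is the discriminant ideal of $\mathcal{O}_K$ over $\mathbb{F}_q[t]$; "relatively prime to $g$" means no irreducible factor of $g$ divides it. *)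

theory Defs
  imports "HOL-Computational_Algebra.Polynomial_Factorial" "HOL-Algebra.QuotRing"
    "HOL-Combinatorics.Permutations"
begin

definition carmichael_ring :: "('a, 'b) ring_scheme \<Rightarrow> bool" where
  "carmichael_ring S \<longleftrightarrow> finite (carrier S) \<and> \<not> field S \<and>
     (\<forall>a \<in> carrier S. a [^]\<^bsub>S\<^esub> card (carrier S) = a)"

definition carmichael_ideal :: "('a, 'b) ring_scheme \<Rightarrow> 'a set \<Rightarrow> bool" where
  "carmichael_ideal R I \<longleftrightarrow> carmichael_ring (R Quot I)"

definition subring_struct :: "'a::comm_ring_1 set \<Rightarrow> 'a ring" where
  "subring_struct A = \<lparr>carrier = A, mult = (*), one = 1, zero = 0, add = (+)\<rparr>"

definition poly_ring :: "('f::{finite,field}) poly ring" where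
  "poly_ring = subring_struct UNIV"

definition carmichael_poly :: "('f::{finite,field}) poly \<Rightarrow> bool" where
  "carmichael_poly g \<longleftrightarrow> carmichael_ideal poly_ring (Idl\<^bsub>poly_ring\<^esub> {g})"

text \<open>A field extension K/F_q(t) is given by a field type 'k together with a field
  homomorphism emb from F_q(t) = 'f poly fract into 'k.\<close>

definition field_hom :: "('a::field \<Rightarrow> 'b::field) \<Rightarrow> bool" where
  "field_hom e \<longleftrightarrow> e 1 = 1 \<and> (\<forall>x y. e (x + y) = e x + e y) \<and> (\<forall>x y. e (x * y) = e x * e y)"

definition base_field :: "('f::{finite,field} poly fract \<Rightarrow> 'k::field) \<Rightarrow> 'k set" where
  "base_field emb = range emb"

definition is_basis ::
  "('f::{finite,field} poly fract \<Rightarrow> 'k::field) \<Rightarrow> nat \<Rightarrow> (nat \<Rightarrow> 'k) \<Rightarrow> bool" where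
  "is_basis emb n b \<longleftrightarrow>
     (\<forall>x. \<exists>c. (\<forall>i<n. c i \<in> base_field emb) \<and> x = (\<Sum>i<n. c i * b i)) \<and>
     (\<forall>c. (\<forall>i<n. c i \<in> base_field emb) \<and> (\<Sum>i<n. c i * b i) = 0 \<longrightarrow> (\<forall>i<n. c i = 0))"

definition finite_ext :: "('f::{finite,field} poly fract \<Rightarrow> 'k::field) \<Rightarrow> bool" where
  "finite_ext emb \<longleftrightarrow> (\<exists>n b. is_basis emb n b)"

definition ext_degree :: "('f::{finite,field} poly fract \<Rightarrow> 'k::field) \<Rightarrow> nat" where
  "ext_degree emb = (THE n. \<exists>b. is_basis emb n b)"

definition ext_basis :: "('f::{finite,field} poly fract \<Rightarrow> 'k::field) \<Rightarrow> nat \<Rightarrow> 'k" where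
  "ext_basis emb = (SOME b. is_basis emb (ext_degree emb) b)"

definition ext_auts :: "('f::{finite,field} poly fract \<Rightarrow> 'k::field) \<Rightarrow> ('k \<Rightarrow> 'k) set" where
  "ext_auts emb = {\<sigma>. bij \<sigma> \<and> field_hom \<sigma> \<and> (\<forall>x \<in> base_field emb. \<sigma> x = x)}"

definition galois_ext :: "('f::{finite,field} poly fract \<Rightarrow> 'k::field) \<Rightarrow> bool" where
  "galois_ext emb \<longleftrightarrow> finite_ext emb \<and> finite (ext_auts emb) \<and>
     card (ext_auts emb) = ext_degree emb"

text \<open>Coordinates w.r.t. the chosen basis, and the trace K \<rightarrow> F_q(t) (as an element of K),
  i.e. the trace of the F_q(t)-linear multiplication map.\<close>
definition coord :: "('f::{finite,field} poly fract \<Rightarrow> 'k::field) \<Rightarrow> 'k \<Rightarrow> nat \<Rightarrow> 'k" where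
  "coord emb y = (SOME c. (\<forall>i<ext_degree emb. c i \<in> base_field emb) \<and>
                       y = (\<Sum>i<ext_degree emb. c i * ext_basis emb i))"

definition ext_trace :: "('f::{finite,field} poly fract \<Rightarrow> 'k::field) \<Rightarrow> 'k \<Rightarrow> 'k" where
  "ext_trace emb x = (\<Sum>i<ext_degree emb. coord emb (x * ext_basis emb i) i)"

definition poly_emb :: "('f::{finite,field} poly fract \<Rightarrow> 'k::field) \<Rightarrow> 'f poly \<Rightarrow> 'k" where
  "poly_emb emb a = emb (to_fract a)"

definition ring_of_integers :: "('f::{finite,field} poly fract \<Rightarrow> 'k::field) \<Rightarrow> 'k set" where
  "ring_of_integers emb =
     {x. \<exists>n (a :: nat \<Rightarrow> 'f poly). x ^ n + (\<Sum>i<n. poly_emb emb (a i) * x ^ i) = 0}"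

definition O_ring :: "('f::{finite,field} poly fract \<Rightarrow> 'k::field) \<Rightarrow> 'k ring" where
  "O_ring emb = subring_struct (ring_of_integers emb)"

definition carmichael_in :: "('f::{finite,field} poly fract \<Rightarrow> 'k::field) \<Rightarrow> 'k \<Rightarrow> bool" where
  "carmichael_in emb \<alpha> \<longleftrightarrow> \<alpha> \<in> ring_of_integers emb \<and>
     carmichael_ideal (O_ring emb) (Idl\<^bsub>O_ring emb\<^esub> {\<alpha>})"

definition det_n :: "nat \<Rightarrow> (nat \<Rightarrow> nat \<Rightarrow> 'a::comm_ring_1) \<Rightarrow> 'a" where
  "det_n n A = (\<Sum>p | p permutes {..<n}. of_int (sign p) * (\<Prod>i<n. A i (p i)))"

definition discriminant_ideal :: "('f::{finite,field} poly fract \<Rightarrow> 'k::field) \<Rightarrow> 'f poly set" where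
  "discriminant_ideal emb = Idl\<^bsub>poly_ring\<^esub>
     {d. \<exists>x. (\<forall>i<ext_degree emb. x i \<in> ring_of_integers emb) \<and>
           poly_emb emb d = det_n (ext_degree emb) (\<lambda>i j. ext_trace emb (x i * x j))}"

definition rel_prime_ideal :: "'f::{finite,field} poly set \<Rightarrow> 'f poly \<Rightarrow> bool" where
  "rel_prime_ideal I g \<longleftrightarrow> (\<forall>p. irreducible p \<and> p dvd g \<longrightarrow> \<not> (\<forall>d \<in> I. p dvd d))"

end

theory Submission
  imports "Jordan_Normal_Form.Char_Poly" Defs "HOL-Algebra.Multiplicative_Group" "HOL-Algebra.Sylow"
begin

text \<open>Let \<open>Q\<close> be the cardinality of the residue ring of \<open>g\<close> and \<open>n\<close> the degree of the extension.
  The ring of integers \<open>\<O>\<close> has a basis \<open>x\<^sub>0, \<dots>, x\<^sub>n\<^sub>-\<^sub>1\<close> over the polynomials, so \<open>\<O>/g\<O>\<close> has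
  \<open>Q ^ n\<close> elements, and the discriminant of the basis divides all others; hence it is a unit modulo
  \<open>g\<close>, and so is the determinant of the matrix of conjugates \<open>\<sigma>\<^sub>j x\<^sub>i\<close>. Because \<open>g\<close> is Carmichael,
  \<open>\<phi> y = y ^ Q\<close> is linear over the polynomials modulo \<open>g\<close>; inverting the matrix of conjugates gives
  \<open>\<phi> = \<Sum>\<^sub>j c\<^sub>j \<sigma>\<^sub>j\<close> modulo \<open>g\<close>. Comparing \<open>\<phi> (z y)\<close> with \<open>\<phi> z * \<phi> y\<close> gives
  \<open>c\<^sub>j \<phi> = c\<^sub>j \<sigma>\<^sub>j\<close>, and \<open>\<sigma>\<^sub>j ^ n = 1\<close> together with \<open>\<Sum>\<^sub>j c\<^sub>j = \<phi> 1 = 1\<close> yields \<open>\<phi> ^ n = 1\<close>. No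
  factorisation of \<open>g\<close> in \<open>\<O>\<close> is needed.\<close>

hide_const (open) Ring_Hom.field_hom

section \<open>Finite groups and finite domains\<close>

lemma prime_power_if_unique_prime_factor:
  fixes n p :: nat
  assumes "n > 0" "prime p" "\<And>r. prime r \<Longrightarrow> r dvd n \<Longrightarrow> r = p"
  shows "\<exists>k. n = p ^ k"
proof -
  have "\<not> is_unit p" using \<open>prime p\<close> by auto
  with \<open>n > 0\<close> obtain m where m: "n = p ^ multiplicity p n * m" "\<not> p dvd m"
    using multiplicity_decompose'[of n p] by (metis mult.commute less_not_refl)
  have "m = 1"
  proof (rule ccontr)
    assume "m \<noteq> 1"
    then obtain r where r: "prime r" "r dvd m" using prime_factor_nat by blast
    then have "r dvd n" using m(1) by (metis dvd_mult)
    then show False using assms(3) r m(2) by blast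
  qed
  then show ?thesis using m(1) by auto
qed

lemma (in group) order_prime_power_if_prime_exponent:
  assumes fin: "finite (carrier G)" and p: "prime p"
    and exp: "\<And>x. x \<in> carrier G \<Longrightarrow> x [^] p = \<one>"
  shows "\<exists>k. order G = p ^ k"
proof (rule prime_power_if_unique_prime_factor)
  show "order G > 0" using fin order_gt_0_iff_finite by blast
  show "prime p" by fact
  fix r assume r: "prime r" "r dvd order G"
  obtain m where m: "order G = r ^ 1 * m" using r(2) by (auto elim: dvdE)
  obtain H where H: "subgroup H G" "card H = r ^ 1"
    using sylow_thm[OF r(1) is_group m fin] by blast
  interpret H: group "G\<lparr>carrier := H\<rparr>" using H(1) by (rule subgroup_imp_group)
  have "card H > 1" using H(2) r(1) prime_gt_1_nat by auto
  then have "\<not> H \<subseteq> {\<one>}" using card_mono[of "{\<one>}" H] by auto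
  then obtain x where x: "x \<in> H" "x \<noteq> \<one>" by blast
  have xG: "x \<in> carrier G" using subgroup.mem_carrier[OF H(1) x(1)] .
  have "x [^]\<^bsub>G\<lparr>carrier := H\<rparr>\<^esub> order (G\<lparr>carrier := H\<rparr>) = \<one>"
    using H.pow_order_eq_1[of x] x by simp
  then have "x [^] r = \<one>" using H(2) nat_pow_consistent[of x r H] by (simp add: order_def)
  then have "ord x dvd r" using pow_eq_id[OF xG] by simp
  moreover have "ord x dvd p" using exp[OF xG] pow_eq_id[OF xG, THEN iffD1] by blast
  moreover have "ord x \<noteq> 1" using x(2) ord_eq_1[OF xG] by blast
  ultimately show "r = p" using r(1) p by (metis primes_dvd_imp_eq prime_nat_iff)
qed

lemma (in "domain") field_if_finite:
  assumes "finite (carrier R)"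
  shows "field R"
proof (rule cring_fieldI2)
  show "\<zero> \<noteq> \<one>" by simp
  fix a assume a: "a \<in> carrier R" "a \<noteq> \<zero>"
  have "inj_on (\<lambda>b. a \<otimes> b) (carrier R)" using a by (auto simp: inj_on_def m_lcancel)
  moreover have "(\<lambda>b. a \<otimes> b) ` carrier R \<subseteq> carrier R" using a(1) by auto
  ultimately have "(\<lambda>b. a \<otimes> b) ` carrier R = carrier R" using assms by (simp add: endo_inj_surj)
  then show "\<exists>b\<in>carrier R. a \<otimes> b = \<one>" using one_closed by (metis imageE)
qed

lemma (in ring_hom_ring) field_quotient_vimage_if_finite:
  assumes "cring R" "cring S" and "ideal I S" "field (S Quot I)"
    and "finite (carrier (R Quot {r \<in> carrier R. h r \<in> I}))"
  shows "field (R Quot {r \<in> carrier R. h r \<in> I})"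
proof -
  have "primeideal I S"
    using assms(3,4) cring.quot_domain_iff_primeideal[OF assms(2)] by (simp add: field_def)
  then have "primeideal {r \<in> carrier R. h r \<in> I} R"
    using primeideal_vimage[OF assms(1)] by simp
  then interpret Q: "domain" "R Quot {r \<in> carrier R. h r \<in> I}"
    by (rule primeideal.quotient_is_domain)
  show ?thesis using assms(5) by (rule Q.field_if_finite)
qed

section \<open>Quotients of subrings by principal ideals\<close>

locale subring_set =
  fixes A :: "'a::comm_ring_1 set"
  assumes one_closed [intro, simp]: "1 \<in> A"
    and add_closed [intro]: "\<And>x y. x \<in> A \<Longrightarrow> y \<in> A \<Longrightarrow> x + y \<in> A"
    and mult_closed [intro]: "\<And>x y. x \<in> A \<Longrightarrow> y \<in> A \<Longrightarrow> x * y \<in> A"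
    and uminus_closed [intro]: "\<And>x. x \<in> A \<Longrightarrow> - x \<in> A"
begin

lemma zero_closed [intro, simp]: "0 \<in> A"
  using add_closed[OF one_closed uminus_closed[OF one_closed]] by simp

lemma diff_closed [intro]: "x \<in> A \<Longrightarrow> y \<in> A \<Longrightarrow> x - y \<in> A"
  using add_closed[of x "- y"] uminus_closed[of y] by simp

lemma power_closed [intro]: "x \<in> A \<Longrightarrow> x ^ n \<in> A"
  by (induction n) auto

lemma sum_closed: "(\<And>i. i \<in> I \<Longrightarrow> f i \<in> A) \<Longrightarrow> sum f I \<in> A"
  by (induction I rule: infinite_finite_induct) auto

lemma prod_closed: "(\<And>i. i \<in> I \<Longrightarrow> f i \<in> A) \<Longrightarrow> prod f I \<in> A"
  by (induction I rule: infinite_finite_induct) auto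

definition cong_mod :: "'a \<Rightarrow> 'a \<Rightarrow> 'a \<Rightarrow> bool" where
  "cong_mod \<alpha> x y \<longleftrightarrow> (\<exists>z\<in>A. x - y = \<alpha> * z)"

lemma cong_mod_refl [simp]: "cong_mod \<alpha> x x"
  unfolding cong_mod_def by (intro bexI[of _ 0]) auto

lemma cong_mod_sym: "cong_mod \<alpha> x y \<Longrightarrow> cong_mod \<alpha> y x"
  unfolding cong_mod_def by (metis minus_diff_eq mult_minus_right uminus_closed)

lemma cong_mod_add:
  assumes "cong_mod \<alpha> x y" "cong_mod \<alpha> u v"
  shows "cong_mod \<alpha> (x + u) (y + v)"
proof -
  obtain a c where "a \<in> A" "c \<in> A" "x - y = \<alpha> * a" "u - v = \<alpha> * c"
    using assms unfolding cong_mod_def by blast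
  then have "a + c \<in> A" "x + u - (y + v) = \<alpha> * (a + c)" by (auto simp: algebra_simps)
  then show ?thesis unfolding cong_mod_def by blast
qed

lemma cong_mod_trans [trans]: "cong_mod \<alpha> x y \<Longrightarrow> cong_mod \<alpha> y z \<Longrightarrow> cong_mod \<alpha> x z"
  using cong_mod_add[of \<alpha> x y y z] by (simp add: cong_mod_def algebra_simps)

lemma cong_mod_mult_left:
  assumes "c \<in> A" "cong_mod \<alpha> x y"
  shows "cong_mod \<alpha> (c * x) (c * y)"
proof -
  obtain a where "a \<in> A" "x - y = \<alpha> * a" using assms(2) unfolding cong_mod_def by blast
  then have "c * a \<in> A" "c * x - c * y = \<alpha> * (c * a)"
    using assms(1) by (auto simp: right_diff_distrib[symmetric])
  then show ?thesis unfolding cong_mod_def by blast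
qed

lemma cong_mod_mult_right: "c \<in> A \<Longrightarrow> cong_mod \<alpha> x y \<Longrightarrow> cong_mod \<alpha> (x * c) (y * c)"
  using cong_mod_mult_left[of c \<alpha> x y] by (simp add: mult.commute)

lemma cong_mod_sum:
  "(\<And>i. i \<in> I \<Longrightarrow> cong_mod \<alpha> (f i) (f' i)) \<Longrightarrow> cong_mod \<alpha> (sum f I) (sum f' I)"
  by (induction I rule: infinite_finite_induct) (auto intro: cong_mod_add)

lemma cong_mod_diff_iff: "cong_mod \<alpha> (x - y) 0 \<longleftrightarrow> cong_mod \<alpha> x y"
  by (simp add: cong_mod_def)

lemma cring_subring_struct: "cring (subring_struct A)"
proof (rule cringI)
  show "abelian_group (subring_struct A)"
  proof (rule abelian_groupI)
    fix x assume "x \<in> carrier (subring_struct A)"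
    then show "\<exists>y\<in>carrier (subring_struct A). y \<oplus>\<^bsub>subring_struct A\<^esub> x = \<zero>\<^bsub>subring_struct A\<^esub>"
      by (intro bexI[of _ "- x"]) (auto simp: subring_struct_def)
  qed (auto simp: subring_struct_def add_ac)
  show "Group.comm_monoid (subring_struct A)"
    by (rule comm_monoidI) (auto simp: subring_struct_def mult_ac)
qed (auto simp: subring_struct_def distrib_right)

sublocale struct: cring "subring_struct A"
  by (rule cring_subring_struct)

lemma carrier_subring_struct [simp]: "carrier (subring_struct A) = A"
  by (simp add: subring_struct_def)

lemma zero_subring_struct: "\<zero>\<^bsub>subring_struct A\<^esub> = 0"
  by (simp add: subring_struct_def)

lemma subring_struct_minus:
  assumes "x \<in> A" "y \<in> A"
  shows "x \<ominus>\<^bsub>subring_struct A\<^esub> y = x - y"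
proof -
  have "\<ominus>\<^bsub>subring_struct A\<^esub> y = - y"
    by (rule struct.minus_equality) (use assms in \<open>auto simp: subring_struct_def\<close>)
  then show ?thesis by (simp add: a_minus_def subring_struct_def)
qed

lemma subring_struct_power: "x [^]\<^bsub>subring_struct A\<^esub> (n::nat) = x ^ n"
  by (induction n) (simp_all add: subring_struct_def mult.commute)

lemma subring_struct_nat_multiple:
  "x [^]\<^bsub>add_monoid (subring_struct A)\<^esub> (n::nat) = of_nat n * x"
  by (induction n) (simp_all add: subring_struct_def nat_pow_def distrib_right add.commute)

abbreviation principal_ideal :: "'a \<Rightarrow> 'a set" where
  "principal_ideal \<alpha> \<equiv> Idl\<^bsub>subring_struct A\<^esub> {\<alpha>}"

abbreviation quotient_by :: "'a \<Rightarrow> 'a set ring" where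
  "quotient_by \<alpha> \<equiv> subring_struct A Quot principal_ideal \<alpha>"

abbreviation residue :: "'a \<Rightarrow> 'a \<Rightarrow> 'a set" where
  "residue \<alpha> x \<equiv> principal_ideal \<alpha> +>\<^bsub>subring_struct A\<^esub> x"

context
  fixes \<alpha>
  assumes generator_closed: "\<alpha> \<in> A"
begin

lemma ideal_principal_ideal: "ideal (principal_ideal \<alpha>) (subring_struct A)"
  by (rule struct.genideal_ideal) (simp add: generator_closed)

interpretation ideal "principal_ideal \<alpha>" "subring_struct A"
  by (rule ideal_principal_ideal)

interpretation residue: ring_hom_ring "subring_struct A" "quotient_by \<alpha>" "residue \<alpha>"
  by (rule rcos_ring_hom_ring)

lemma principal_ideal_eq: "principal_ideal \<alpha> = {\<alpha> * z |z. z \<in> A}"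
  using struct.cgenideal_eq_genideal[of \<alpha>] generator_closed
  by (auto simp: cgenideal_def subring_struct_def mult.commute)

lemma residue_eq_iff:
  assumes "x \<in> A" "y \<in> A"
  shows "residue \<alpha> x = residue \<alpha> y \<longleftrightarrow> cong_mod \<alpha> x y"
proof -
  have "residue \<alpha> x = residue \<alpha> y \<longleftrightarrow> x - y \<in> principal_ideal \<alpha>"
    using struct.quotient_eq_iff_same_a_r_cos[OF ideal_principal_ideal, of x y] assms
    by (simp add: subring_struct_minus)
  then show ?thesis by (auto simp: principal_ideal_eq cong_mod_def)
qed

lemma carrier_quotient: "carrier (quotient_by \<alpha>) = residue \<alpha> ` A"
  by (auto simp: FactRing_def A_RCOSETS_def' subring_struct_def)

lemma residue_power_eq_iff:
  assumes "a \<in> A"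
  shows "residue \<alpha> a [^]\<^bsub>quotient_by \<alpha>\<^esub> (n::nat) = residue \<alpha> a \<longleftrightarrow> cong_mod \<alpha> (a ^ n) a"
proof -
  have "residue \<alpha> a [^]\<^bsub>quotient_by \<alpha>\<^esub> n = residue \<alpha> (a ^ n)"
    using residue.hom_nat_pow[of a n] assms
    by (simp add: subring_struct_power)
  then show ?thesis using assms by (simp add: residue_eq_iff power_closed)
qed

lemma carmichael_ideal_iff:
  "carmichael_ideal (subring_struct A) (principal_ideal \<alpha>) \<longleftrightarrow>
     finite (carrier (quotient_by \<alpha>)) \<and> \<not> field (quotient_by \<alpha>) \<and>
     (\<forall>a\<in>A. cong_mod \<alpha> (a ^ card (carrier (quotient_by \<alpha>))) a)"
proof -
  have "(\<forall>x\<in>carrier (quotient_by \<alpha>). x [^]\<^bsub>quotient_by \<alpha>\<^esub> N = x) \<longleftrightarrow>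
    (\<forall>a\<in>A. cong_mod \<alpha> (a ^ N) a)" for N :: nat
    by (auto simp: carrier_quotient residue_power_eq_iff)
  then show ?thesis
    by (simp only: carmichael_ideal_def carmichael_ring_def)
qed

lemma bij_betw_quotient:
  assumes "f ` S \<subseteq> A" "\<And>a. a \<in> A \<Longrightarrow> \<exists>s\<in>S. cong_mod \<alpha> a (f s)"
    and "\<And>s t. s \<in> S \<Longrightarrow> t \<in> S \<Longrightarrow> cong_mod \<alpha> (f s) (f t) \<Longrightarrow> s = t"
  shows "bij_betw (\<lambda>s. residue \<alpha> (f s)) S (carrier (quotient_by \<alpha>))"
proof (rule bij_betw_imageI)
  show "inj_on (\<lambda>s. residue \<alpha> (f s)) S"
    using assms(1,3) by (auto simp: inj_on_def residue_eq_iff image_subset_iff)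
  have "residue \<alpha> a \<in> (\<lambda>s. residue \<alpha> (f s)) ` S" if "a \<in> A" for a
    using assms(1) assms(2)[OF that] that by (auto simp: residue_eq_iff image_iff image_subset_iff)
  then show "(\<lambda>s. residue \<alpha> (f s)) ` S = carrier (quotient_by \<alpha>)"
    using assms(1) by (auto simp: carrier_quotient)
qed

lemma card_quotient_prime_power:
  assumes fin: "finite (carrier (quotient_by \<alpha>))" and p: "prime p" "of_nat p = (0::'a)"
  shows "\<exists>k. card (carrier (quotient_by \<alpha>)) = p ^ k"
proof -
  have "x [^]\<^bsub>add_monoid (quotient_by \<alpha>)\<^esub> p = \<one>\<^bsub>add_monoid (quotient_by \<alpha>)\<^esub>"
    if x: "x \<in> carrier (quotient_by \<alpha>)" for x
  proof -
    obtain a where a: "a \<in> A" "x = residue \<alpha> a" using x unfolding carrier_quotient by blast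
    have "x [^]\<^bsub>add_monoid (quotient_by \<alpha>)\<^esub> p
        = residue \<alpha> (a [^]\<^bsub>add_monoid (subring_struct A)\<^esub> p)"
      unfolding a(2)
      by (rule group_hom.hom_nat_pow[OF residue.a_group_hom, symmetric]) (simp add: a(1))
    also have "\<dots> = residue \<alpha> \<zero>\<^bsub>subring_struct A\<^esub>"
      by (simp only: subring_struct_nat_multiple p(2) mult_zero_left)
        (simp only: zero_subring_struct)
    also have "\<dots> = \<one>\<^bsub>add_monoid (quotient_by \<alpha>)\<^esub>" using residue.hom_zero by simp
    finally show ?thesis .
  qed
  then show ?thesis
    using group.order_prime_power_if_prime_exponent[of "add_monoid (quotient_by \<alpha>)" p]
      residue.S.add.is_group fin p(1) by (simp add: order_def)
qed

end

end

interpretation UNIV: subring_set UNIV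
  by standard auto

lemma cong_mod_UNIV_iff: "UNIV.cong_mod \<alpha> x y \<longleftrightarrow> \<alpha> dvd x - y"
  by (auto simp: UNIV.cong_mod_def dvd_def)

section \<open>Determinants and adjugates of function matrices\<close>

definition mat_n :: "nat \<Rightarrow> (nat \<Rightarrow> nat \<Rightarrow> 'a::comm_ring_1) \<Rightarrow> 'a mat" where
  "mat_n n M = mat n n (\<lambda>(i, j). M i j)"

definition adj_n :: "nat \<Rightarrow> (nat \<Rightarrow> nat \<Rightarrow> 'a::comm_ring_1) \<Rightarrow> nat \<Rightarrow> nat \<Rightarrow> 'a" where
  "adj_n n M i j = adj_mat (mat_n n M) $$ (i, j)"

lemma mat_n_carrier [simp]: "mat_n n M \<in> carrier_mat n n"
  by (simp add: mat_n_def)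

lemma mat_n_index [simp]: "i < n \<Longrightarrow> j < n \<Longrightarrow> mat_n n M $$ (i, j) = M i j"
  by (simp add: mat_n_def)

lemma det_mat_n: "det (mat_n n M) = det_n n M"
  unfolding det_def'[OF mat_n_carrier] det_n_def atLeast0LessThan
proof (intro sum.cong refl arg_cong2[where f = times] prod.cong)
  fix p i assume "p \<in> {p. p permutes {..<n}}" "i \<in> {..<n}"
  then show "mat_n n M $$ (i, p i) = M i (p i)"
    using permutes_in_image[of p "{..<n}" i] by simp
qed

lemma det_n_cong:
  assumes "\<And>i j. i < n \<Longrightarrow> j < n \<Longrightarrow> M i j = N i j"
  shows "det_n n M = det_n n N"
proof -
  have "mat_n n M = mat_n n N" by (rule eq_matI) (auto simp: mat_n_def assms)
  then show ?thesis by (metis det_mat_n)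
qed

lemma (in comm_ring_hom) hom_det_n: "hom (det_n n M) = det_n n (\<lambda>i j. hom (M i j))"
  by (simp add: det_n_def hom_sum hom_mult hom_prod)

lemma mat_mult_index_sum:
  "B \<in> carrier_mat n n \<Longrightarrow> C \<in> carrier_mat n n \<Longrightarrow> i < n \<Longrightarrow> j < n \<Longrightarrow>
    (B * C) $$ (i, j) = (\<Sum>k<n. B $$ (i, k) * C $$ (k, j))"
  by (auto simp: scalar_prod_def atLeast0LessThan)

lemma det_n_mult: "det_n n (\<lambda>i j. \<Sum>k<n. M i k * N k j) = det_n n M * det_n n N"
proof -
  have "mat_n n (\<lambda>i j. \<Sum>k<n. M i k * N k j) = mat_n n M * mat_n n N"
    by (rule eq_matI) (auto simp: mat_n_def scalar_prod_def atLeast0LessThan)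
  then show ?thesis
    using det_mult[OF mat_n_carrier mat_n_carrier, of n M N] by (simp add: det_mat_n[symmetric])
qed

lemma det_n_transpose: "det_n n (\<lambda>i j. M j i) = det_n n M"
proof -
  have "mat_n n (\<lambda>i j. M j i) = transpose_mat (mat_n n M)"
    by (rule eq_matI) (auto simp: mat_n_def)
  then show ?thesis
    using det_transpose[OF mat_n_carrier, of n M] by (simp add: det_mat_n[symmetric])
qed

lemma det_n_scale_rows: "det_n n (\<lambda>i j. c i * M i j) = (\<Prod>i<n. c i) * det_n n M"
  by (simp add: det_n_def prod.distrib sum_distrib_left mult_ac)

lemma det_n_identity_update_row:
  assumes i: "i < n"
  shows "det_n n (\<lambda>k l. if k = i then r l else if k = l then 1 else 0) = r i"
    (is "det_n n ?E = _")
proof -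
  have "of_int (sign p) * (\<Prod>k<n. ?E k (p k)) = 0" if p: "p permutes {..<n}" "p \<noteq> id" for p
  proof -
    have "\<exists>k. k \<noteq> i \<and> p k \<noteq> k"
    proof (rule ccontr)
      assume "\<not> ?thesis"
      then have "p k = k" for k
        using permutes_inj[OF p(1)] by (metis injD)
      then show False using p(2) by auto
    qed
    then obtain k where k: "k \<noteq> i" "p k \<noteq> k" by blast
    then have "k < n" using permutes_not_in[OF p(1), of k] by auto
    then have "(\<Prod>k<n. ?E k (p k)) = 0" using k by (intro prod_zero) (auto intro!: bexI[of _ k])
    then show ?thesis by simp
  qed
  then have "det_n n ?E = (\<Sum>p\<in>{id}. of_int (sign p) * (\<Prod>k<n. ?E k (p k)))"
    unfolding det_n_def
    by (intro sum.mono_neutral_right) (auto simp: permutes_id finite_permutations)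
  also have "\<dots> = (\<Prod>k<n. if k = i then r k else 1)"
    by (simp add: sign_id cong: if_cong)
  also have "\<dots> = r i" using i by simp
  finally show ?thesis .
qed

lemma det_n_update_row_combination:
  assumes "i < n"
  shows "det_n n (M(i := \<lambda>j. \<Sum>k<n. r k * M k j)) = r i * det_n n M"
proof -
  have "det_n n (M(i := \<lambda>j. \<Sum>k<n. r k * M k j)) =
      det_n n (\<lambda>k j. \<Sum>l<n. (if k = i then r l else if k = l then 1 else 0) * M l j)"
    by (rule det_n_cong) (simp add: if_distribR if_distrib[of "\<lambda>x. x * _"] cong: if_cong)
  then show ?thesis by (simp only: det_n_mult det_n_identity_update_row[OF assms])
qed

lemma det_n_update_row_eq:
  fixes M :: "nat \<Rightarrow> nat \<Rightarrow> 'a::comm_ring_1"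
  assumes "i < n" and "\<And>j. j < n \<Longrightarrow> c * v j = (\<Sum>k<n. r k * M k j)"
  shows "c * det_n n (M(i := v)) = r i * det_n n M"
proof -
  have "c * det_n n (M(i := v)) =
      det_n n ((M(i := v))(i := \<lambda>j. \<Sum>k<n. (if k = i then c else 0) * (M(i := v)) k j))"
    using det_n_update_row_combination[OF assms(1), of "M(i := v)" "\<lambda>k. if k = i then c else 0"]
    by simp
  also have "\<dots> = det_n n (M(i := \<lambda>j. \<Sum>k<n. r k * M k j))"
    using assms by (intro det_n_cong) (auto simp: if_distrib[of "\<lambda>x. x * _"] cong: if_cong)
  finally show ?thesis using det_n_update_row_combination[OF assms(1), of M r] by simp
qed

lemma det_n_eq_0_iff:
  fixes M :: "nat \<Rightarrow> nat \<Rightarrow> 'a::idom"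
  shows "det_n n M = 0 \<longleftrightarrow> (\<exists>v. (\<exists>j<n. v j \<noteq> 0) \<and> (\<forall>i<n. (\<Sum>j<n. M i j * v j) = 0))"
proof -
  have mult: "(mat_n n M *\<^sub>v w) $ i = (\<Sum>j<n. M i j * w $ j)" if "w \<in> carrier_vec n" "i < n" for w i
    using that by (auto simp: scalar_prod_def mat_n_def atLeast0LessThan)
  have "det_n n M = 0 \<longleftrightarrow> (\<exists>w\<in>carrier_vec n. w \<noteq> 0\<^sub>v n \<and> mat_n n M *\<^sub>v w = 0\<^sub>v n)"
    using det_0_iff_vec_prod_zero[OF mat_n_carrier, of n M] by (auto simp: det_mat_n)
  also have "\<dots> \<longleftrightarrow> (\<exists>v. (\<exists>j<n. v j \<noteq> 0) \<and> (\<forall>i<n. (\<Sum>j<n. M i j * v j) = 0))"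
  proof
    assume "\<exists>w\<in>carrier_vec n. w \<noteq> 0\<^sub>v n \<and> mat_n n M *\<^sub>v w = 0\<^sub>v n"
    then obtain w where w: "w \<in> carrier_vec n" "w \<noteq> 0\<^sub>v n" "mat_n n M *\<^sub>v w = 0\<^sub>v n" by blast
    have "\<exists>j<n. w $ j \<noteq> 0" using w(1,2) by (metis carrier_vecD eq_vecI index_zero_vec)
    then show "\<exists>v. (\<exists>j<n. v j \<noteq> 0) \<and> (\<forall>i<n. (\<Sum>j<n. M i j * v j) = 0)"
      using w(1,3) mult[OF w(1)] by (intro exI[of _ "\<lambda>j. w $ j"]) auto
  next
    assume "\<exists>v. (\<exists>j<n. v j \<noteq> 0) \<and> (\<forall>i<n. (\<Sum>j<n. M i j * v j) = 0)"
    then obtain v where v: "\<exists>j<n. v j \<noteq> 0" "\<forall>i<n. (\<Sum>j<n. M i j * v j) = 0" by blast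
    have "vec n v \<noteq> 0\<^sub>v n" using v(1) by (metis index_vec index_zero_vec(1))
    moreover have "mat_n n M *\<^sub>v vec n v = 0\<^sub>v n"
    proof (rule eq_vecI)
      show "(mat_n n M *\<^sub>v vec n v) $ i = 0\<^sub>v n $ i" if "i < dim_vec (0\<^sub>v n :: 'a vec)" for i
        using that v(2) mult[of "vec n v" i] by simp
    qed (simp add: mat_n_def)
    ultimately show "\<exists>w\<in>carrier_vec n. w \<noteq> 0\<^sub>v n \<and> mat_n n M *\<^sub>v w = 0\<^sub>v n" by auto
  qed
  finally show ?thesis .
qed

lemma det_n_nonzero_kernelD:
  fixes M :: "nat \<Rightarrow> nat \<Rightarrow> 'a::idom"
  assumes "det_n n M \<noteq> 0" "\<And>i. i < n \<Longrightarrow> (\<Sum>j<n. M i j * v j) = 0" "j < n"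
  shows "v j = 0"
  using assms det_n_eq_0_iff[of n M] by auto

lemma mat_mult_adj_n:
  assumes "i < n" "j < n"
  shows "(\<Sum>k<n. M i k * adj_n n M k j) = (if i = j then det_n n M else 0)"
proof -
  have "(mat_n n M * adj_mat (mat_n n M)) $$ (i, j) = (\<Sum>k<n. M i k * adj_n n M k j)"
    using assms by (subst mat_mult_index_sum[of _ n]) (auto simp: adj_mat adj_n_def)
  then show ?thesis
    using assms by (auto simp: adj_mat(2)[OF mat_n_carrier] det_mat_n split: if_splits)
qed

lemma adj_n_mult_mat:
  assumes "i < n" "j < n"
  shows "(\<Sum>k<n. adj_n n M i k * M k j) = (if i = j then det_n n M else 0)"
proof -
  have "(adj_mat (mat_n n M) * mat_n n M) $$ (i, j) = (\<Sum>k<n. adj_n n M i k * M k j)"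
    using assms by (subst mat_mult_index_sum[of _ n]) (auto simp: adj_mat adj_n_def)
  then show ?thesis
    using assms by (auto simp: adj_mat(3)[OF mat_n_carrier] det_mat_n split: if_splits)
qed

lemma mat_mult_eq_scalar_apply:
  fixes M N :: "nat \<Rightarrow> nat \<Rightarrow> 'a::comm_ring_1"
  assumes "i < n" and "\<And>j. j < n \<Longrightarrow> (\<Sum>k<n. M i k * N k j) = (if i = j then d else 0)"
  shows "(\<Sum>k<n. M i k * (\<Sum>j<n. N k j * v j)) = d * v i"
proof -
  have "(\<Sum>k<n. M i k * (\<Sum>j<n. N k j * v j)) = (\<Sum>k<n. \<Sum>j<n. M i k * N k j * v j)"
    by (simp add: sum_distrib_left mult.assoc)
  also have "\<dots> = (\<Sum>j<n. (\<Sum>k<n. M i k * N k j) * v j)"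
    by (subst sum.swap) (simp add: sum_distrib_right)
  also have "\<dots> = (\<Sum>j<n. if i = j then d * v j else 0)"
    by (intro sum.cong) (simp_all add: assms(2))
  also have "\<dots> = d * v i" using assms(1) by simp
  finally show ?thesis .
qed

lemma mat_mult_adj_n_apply:
  "i < n \<Longrightarrow> (\<Sum>k<n. M i k * (\<Sum>j<n. adj_n n M k j * v j)) = det_n n M * v i"
  by (rule mat_mult_eq_scalar_apply) (simp_all add: mat_mult_adj_n)

lemma adj_n_mult_mat_apply:
  "i < n \<Longrightarrow> (\<Sum>k<n. adj_n n M i k * (\<Sum>j<n. M k j * v j)) = det_n n M * v i"
  by (rule mat_mult_eq_scalar_apply) (simp_all add: adj_n_mult_mat)

lemma trace_eq_sum_eigenvalues:
  fixes m B :: "nat \<Rightarrow> nat \<Rightarrow> 'a::idom"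
  assumes eigen: "\<And>i j. i < n \<Longrightarrow> j < n \<Longrightarrow> (\<Sum>k<n. m i k * B k j) = ev j * B i j"
    and det: "det_n n B \<noteq> 0"
  shows "(\<Sum>i<n. m i i) = (\<Sum>j<n. ev j)"
proof -
  have diagonal: "det_n n B * m i i = (\<Sum>j<n. ev j * (adj_n n B j i * B i j))" if i: "i < n" for i
  proof -
    have "det_n n B * m i i = (\<Sum>k<n. m i k * (\<Sum>j<n. B k j * adj_n n B j i))"
      using i by (simp add: mat_mult_adj_n if_distrib[of "\<lambda>x. _ * x"] mult.commute cong: if_cong)
    also have "\<dots> = (\<Sum>j<n. (\<Sum>k<n. m i k * B k j) * adj_n n B j i)"
      by (simp only: sum_distrib_left sum_distrib_right mult.assoc) (rule sum.swap)
    also have "\<dots> = (\<Sum>j<n. ev j * (adj_n n B j i * B i j))"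
      using i by (intro sum.cong) (auto simp: eigen)
    finally show ?thesis .
  qed
  have "det_n n B * (\<Sum>i<n. m i i) = (\<Sum>i<n. \<Sum>j<n. ev j * (adj_n n B j i * B i j))"
    by (simp add: sum_distrib_left diagonal)
  also have "\<dots> = (\<Sum>j<n. ev j * (\<Sum>i<n. adj_n n B j i * B i j))"
    by (simp only: sum_distrib_left) (rule sum.swap)
  also have "\<dots> = (\<Sum>j<n. ev j * det_n n B)"
    by (intro sum.cong refl arg_cong2[where f = times]) (simp add: adj_n_mult_mat)
  also have "\<dots> = det_n n B * (\<Sum>j<n. ev j)"
    by (simp add: sum_distrib_left mult.commute)
  finally show ?thesis using det by simp
qed

context subring_set
begin

lemma det_closed:
  assumes "B \<in> carrier_mat m m" "\<And>i j. i < m \<Longrightarrow> j < m \<Longrightarrow> B $$ (i, j) \<in> A"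
  shows "det B \<in> A"
  unfolding det_def'[OF assms(1)]
proof (intro sum_closed mult_closed prod_closed)
  fix p assume p: "p \<in> {p. p permutes {0..<m}}"
  show "signof p \<in> A" by (auto simp: sign_def)
  fix i assume "i \<in> {0..<m}"
  then show "B $$ (i, p i) \<in> A"
    using p permutes_in_image[of p "{0..<m}" i] by (intro assms(2)) auto
qed

lemma det_n_closed:
  "(\<And>i j. i < n \<Longrightarrow> j < n \<Longrightarrow> M i j \<in> A) \<Longrightarrow> det_n n M \<in> A"
  using det_closed[of "mat_n n M" n] by (simp add: det_mat_n)

lemma adj_n_closed:
  assumes "\<And>i j. i < n \<Longrightarrow> j < n \<Longrightarrow> M i j \<in> A" "i < n" "j < n"
  shows "adj_n n M i j \<in> A"
proof -
  have "det (mat_delete (mat_n n M) j i) \<in> A"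
  proof (rule det_closed)
    show "mat_delete (mat_n n M) j i \<in> carrier_mat (n - 1) (n - 1)"
      by (simp add: mat_n_def mat_delete_def)
    show "mat_delete (mat_n n M) j i $$ (k, l) \<in> A" if "k < n - 1" "l < n - 1" for k l
      using that assms by (auto simp: mat_n_def mat_delete_def)
  qed
  moreover have "(- 1) ^ (j + i) \<in> A" by auto
  ultimately show ?thesis
    using assms(2,3) by (auto simp: adj_n_def adj_mat_def mat_n_def cofactor_def)
qed

lemma mat_mult_adj_n_cong:
  assumes "cong_mod \<alpha> (w * det_n n M) 1" "i < n" "v i \<in> A"
  shows "cong_mod \<alpha> (\<Sum>k<n. M i k * (w * (\<Sum>j<n. adj_n n M k j * v j))) (v i)"
proof -
  have "(\<Sum>k<n. M i k * (w * (\<Sum>j<n. adj_n n M k j * v j)))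
      = w * (\<Sum>k<n. M i k * (\<Sum>j<n. adj_n n M k j * v j))"
    by (subst sum_distrib_left) (simp only: mult.left_commute)
  then show ?thesis
    using cong_mod_mult_right[OF assms(3,1)] by (simp add: mat_mult_adj_n_apply assms(2) mult.assoc)
qed

lemma adj_n_mult_mat_cong:
  assumes "cong_mod \<alpha> (w * det_n n M) 1" "i < n" "v i \<in> A"
  shows "cong_mod \<alpha> (w * (\<Sum>k<n. adj_n n M i k * (\<Sum>j<n. M k j * v j))) (v i)"
  using cong_mod_mult_right[OF assms(3,1)] by (simp add: adj_n_mult_mat_apply assms(2) mult.assoc)

end

section \<open>Bezout identities in Euclidean rings\<close>

lemma euclidean_ring_bezout:
  fixes a b :: "'a::euclidean_ring"
  obtains u v d where "u * a + v * b = d" "d dvd a" "d dvd b"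
proof (induction "euclidean_size b" arbitrary: a b thesis rule: less_induct)
  case less
  show thesis
  proof (cases "b = 0")
    case True
    then show thesis using less.prems[of 1 0 a] by simp
  next
    case False
    then obtain u v d where d: "u * b + v * (a mod b) = d" "d dvd b" "d dvd a mod b"
      using less.hyps[of "a mod b" b] mod_size_less by blast
    have "v * a + (u - v * (a div b)) * b = u * b + v * (a - a div b * b)"
      by (simp add: algebra_simps)
    then have "v * a + (u - v * (a div b)) * b = d" using d(1) by (simp add: minus_div_mult_eq_mod)
    then show thesis using less.prems d(2,3) dvd_mod_imp_dvd by blast
  qed
qed

lemma irreducible_factor_exists:
  fixes a :: "'a::euclidean_ring"
  assumes "a \<noteq> 0" "\<not> a dvd 1"
  obtains p where "irreducible p" "p dvd a"
  using assms
proof (induction "euclidean_size a" arbitrary: a thesis rule: less_induct)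
  case less
  show thesis
  proof (cases "irreducible a")
    case False
    then obtain b c where bc: "a = b * c" "\<not> b dvd 1" "\<not> c dvd 1"
      using less.prems unfolding irreducible_def by blast
    then have "\<not> a dvd b" using less.prems(2) by auto
    then have "euclidean_size b < euclidean_size a"
      using bc(1) less.prems(2) by (intro dvd_proper_imp_size_less) auto
    moreover have "b \<noteq> 0" using bc(1) less.prems(2) by auto
    ultimately obtain p where "irreducible p" "p dvd b" using less.hyps bc(2) by blast
    then show thesis using less.prems(1) bc(1) by (metis dvd_mult2)
  qed (use less.prems(1) in auto)
qed

lemma bezout_one_if_no_common_irreducible_factor:
  fixes a b :: "'a::euclidean_ring"
  assumes "a \<noteq> 0" "\<And>p. irreducible p \<Longrightarrow> p dvd b \<Longrightarrow> \<not> p dvd a"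
  obtains u v where "u * a + v * b = 1"
proof -
  obtain u v d where d: "u * a + v * b = d" "d dvd a" "d dvd b"
    by (rule euclidean_ring_bezout)
  have "d dvd 1"
  proof (rule ccontr)
    assume "\<not> d dvd 1"
    moreover have "d \<noteq> 0" using assms(1) d(2) by auto
    ultimately obtain p where "irreducible p" "p dvd d" using irreducible_factor_exists by blast
    then show False using assms(2) d(2,3) dvd_trans by blast
  qed
  then obtain c where "1 = d * c" by (rule dvdE)
  then have "c * (u * a + v * b) = 1" using d(1) by (simp add: mult.commute)
  then have "(c * u) * a + (c * v) * b = 1" by (simp add: distrib_left mult.assoc)
  then show thesis by (rule that)
qed

lemma dvd_one_if_dvd_power_bezout:
  fixes a b :: "'a::comm_semiring_1_cancel"
  assumes "u * a + v * b = 1" "b dvd a ^ n"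
  shows "b dvd 1"
  using assms(2)
proof (induction n)
  case (Suc n)
  have "a ^ n = (u * a + v * b) * a ^ n" by (simp add: assms(1))
  also have "\<dots> = u * a ^ Suc n + b * (v * a ^ n)" by (simp add: algebra_simps)
  finally have "b dvd a ^ n" using Suc.prems by (metis dvd_add dvd_mult dvd_triv_left)
  then show ?case by (rule Suc.IH)
qed simp

section \<open>Integral elements over a ring homomorphism\<close>

locale hom_to_field = comm_ring_hom hom for hom :: "'a::comm_ring_1 \<Rightarrow> 'b::field"
begin

definition integral_elements :: "'b set" where
  "integral_elements = {x. \<exists>n (a :: nat \<Rightarrow> 'a). x ^ n + (\<Sum>i<n. hom (a i) * x ^ i) = 0}"

lemma module_hom_mult: "Modules.module (\<lambda>a x. hom a * x)"
  by standard (simp_all add: hom_distribs algebra_simps)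

sublocale scalars: Modules.module "\<lambda>a x. hom a * x"
  by (rule module_hom_mult)

lemma integral_if_eigenvalue:
  assumes B: "B \<in> carrier_mat N N" and eigen: "eigenvalue (map_mat hom B) x"
  shows "x \<in> integral_elements"
proof -
  let ?p = "char_poly (map_mat hom B)"
  have hom_B: "map_mat hom B \<in> carrier_mat N N" using B by simp
  have coeff: "Polynomial.coeff ?p i = hom (Polynomial.coeff (char_poly B) i)" for i
    by (simp add: char_poly_hom[OF B] coeff_map_poly)
  have "poly ?p x = 0" using eigen eigenvalue_root_char_poly[OF hom_B] by blast
  then have "(\<Sum>i\<le>N. Polynomial.coeff ?p i * x ^ i) = 0"
    using degree_monic_char_poly[OF hom_B] by (simp add: poly_altdef)
  then have "x ^ N + (\<Sum>i<N. Polynomial.coeff ?p i * x ^ i) = 0"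
    using degree_monic_char_poly[OF hom_B] by (simp add: lessThan_Suc_atMost[symmetric] add.commute)
  then show ?thesis unfolding coeff integral_elements_def by blast
qed

lemma integral_if_stable_span:
  assumes S: "finite S" and nonzero: "t \<in> S" "t \<noteq> 0"
    and stable: "\<And>s. s \<in> S \<Longrightarrow> x * s \<in> scalars.span S"
  shows "x \<in> integral_elements"
proof -
  obtain v where v: "bij_betw v {..<card S} S"
    using S ex_bij_betw_nat_finite by (metis atLeast0LessThan)
  have "\<forall>s\<in>S. \<exists>u. x * s = (\<Sum>t\<in>S. hom (u t) * t)"
    using stable S by (auto simp: scalars.span_finite)
  then obtain u where u: "\<And>s. s \<in> S \<Longrightarrow> x * s = (\<Sum>t\<in>S. hom (u s t) * t)" by metis
  define B where "B = mat_n (card S) (\<lambda>i k. u (v i) (v k))"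
  have row: "x * v i = (\<Sum>k<card S. hom (u (v i) (v k)) * v k)" if "i < card S" for i
    using u[of "v i"] bij_betwE[OF v] that sum.reindex_bij_betw[OF v, of "\<lambda>t. hom (u (v i) t) * t"]
    by simp
  have "eigenvector (map_mat hom B) (vec (card S) v) x"
    unfolding eigenvector_def
  proof (intro conjI)
    show "vec (card S) v \<in> carrier_vec (dim_row (map_mat hom B))" by (simp add: B_def mat_n_def)
    obtain i where "i < card S" "v i = t"
      using nonzero(1) v by (metis bij_betw_iff_bijections lessThan_iff)
    then show "vec (card S) v \<noteq> 0\<^sub>v (dim_row (map_mat hom B))"
      using nonzero(2)
      by (metis B_def carrier_matD(1) index_map_mat(2) index_vec index_zero_vec(1) mat_n_carrier)
    show "map_mat hom B *\<^sub>v vec (card S) v = x \<cdot>\<^sub>v vec (card S) v"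
      by (rule eq_vecI) (auto simp: B_def mat_n_def scalar_prod_def atLeast0LessThan row)
  qed
  then have "eigenvalue (map_mat hom B) x" unfolding eigenvalue_def by blast
  then show ?thesis by (rule integral_if_eigenvalue[of _ "card S", rotated]) (simp add: B_def)
qed

lemma stable_span_mult:
  assumes "\<And>s. s \<in> S \<Longrightarrow> x * s \<in> scalars.span S" "y \<in> scalars.span S"
  shows "x * y \<in> scalars.span S"
  using assms(2)
proof (induction rule: scalars.span_induct_alt)
  case (step c s y)
  have "x * (hom c * s + y) = hom c * (x * s) + x * y" by (simp add: algebra_simps)
  then show ?case using step assms(1) by (simp add: scalars.span_add scalars.span_scale)
qed (simp add: scalars.span_zero)

lemma mult_power_in_span:
  assumes monic: "x ^ n + (\<Sum>i<n. hom (a i) * x ^ i) = 0"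
    and S: "\<And>i. i < n \<Longrightarrow> x ^ i * z \<in> S" and i: "i < n"
  shows "x * (x ^ i * z) \<in> scalars.span S"
proof (cases "Suc i < n")
  case True
  then have "x ^ Suc i * z \<in> S" by (rule S)
  then show ?thesis by (simp add: scalars.span_base mult.assoc)
next
  case False
  then have "Suc i = n" using i by simp
  then have "x * (x ^ i * z) = x ^ n * z" by (auto simp: mult.assoc)
  also have "x ^ n = - (\<Sum>i<n. hom (a i) * x ^ i)" using monic by (simp add: eq_neg_iff_add_eq_0)
  also have "\<dots> * z = - (\<Sum>i<n. hom (a i) * (x ^ i * z))"
    by (simp add: sum_distrib_right mult.assoc)
  also have "\<dots> \<in> scalars.span S"
    by (intro scalars.span_neg scalars.span_sum scalars.span_scale scalars.span_base S) simp
  finally show ?thesis .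
qed

lemma finite_stable_span:
  assumes "x \<in> integral_elements" "y \<in> integral_elements"
  obtains S where "finite S" "1 \<in> S"
    and "\<And>s. s \<in> S \<Longrightarrow> x * s \<in> scalars.span S" "\<And>s. s \<in> S \<Longrightarrow> y * s \<in> scalars.span S"
proof -
  obtain n a where a: "x ^ n + (\<Sum>i<n. hom (a i) * x ^ i) = 0"
    using assms(1) unfolding integral_elements_def by blast
  obtain m b where b: "y ^ m + (\<Sum>j<m. hom (b j) * y ^ j) = 0"
    using assms(2) unfolding integral_elements_def by blast
  have pos: "n > 0" "m > 0" using a b by (auto intro: gr0I)
  define S where "S = (\<lambda>(i, j). x ^ i * y ^ j) ` ({..<n} \<times> {..<m})"
  have in_S: "x ^ i * y ^ j \<in> S" "y ^ j * x ^ i \<in> S" if "i < n" "j < m" for i j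
    using that by (auto simp: S_def mult.commute)
  show thesis
  proof
    show "finite S" by (simp add: S_def)
    show "1 \<in> S" using in_S(1)[OF pos] by simp
    fix s assume "s \<in> S"
    then obtain i j where s: "i < n" "j < m" "s = x ^ i * y ^ j" "s = y ^ j * x ^ i"
      by (auto simp: S_def mult.commute)
    show "x * s \<in> scalars.span S"
      unfolding s(3) using a in_S(1)[OF _ s(2)] s(1) by (rule mult_power_in_span)
    show "y * s \<in> scalars.span S"
      unfolding s(4) using b in_S(2)[OF s(1)] s(2) by (rule mult_power_in_span)
  qed
qed

lemma hom_integral [simp]: "hom a \<in> integral_elements"
proof -
  have "hom a ^ 1 + (\<Sum>i<1. hom (- a) * hom a ^ i) = 0" by (simp add: hom_uminus)
  then show ?thesis
    unfolding integral_elements_def mem_Collect_eq by (intro exI[of _ 1] exI[of _ "\<lambda>_. - a"])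
qed

lemma integral_add_mult:
  assumes "x \<in> integral_elements" "y \<in> integral_elements"
  shows "x + y \<in> integral_elements" "x * y \<in> integral_elements"
proof -
  obtain S where S: "finite S" "1 \<in> S" "\<And>s. s \<in> S \<Longrightarrow> x * s \<in> scalars.span S"
    "\<And>s. s \<in> S \<Longrightarrow> y * s \<in> scalars.span S"
    by (rule finite_stable_span[OF assms]) blast
  show "x + y \<in> integral_elements"
    by (rule integral_if_stable_span[OF S(1,2)])
      (auto simp: distrib_right intro: scalars.span_add S)
  show "x * y \<in> integral_elements"
    by (rule integral_if_stable_span[OF S(1,2)])
      (auto simp: mult.assoc intro: stable_span_mult S)
qed

lemma subring_set_integral_elements: "subring_set integral_elements"
proof
  show "1 \<in> integral_elements" using hom_integral[of 1] by simp
  show "- x \<in> integral_elements" if "x \<in> integral_elements" for x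
    using integral_add_mult(2)[OF hom_integral[of "- 1"] that] by (simp add: hom_uminus)
qed (auto intro: integral_add_mult)

end

locale euclidean_hom_to_field = hom_to_field hom + inj_comm_ring_hom hom
  for hom :: "'a::euclidean_ring \<Rightarrow> 'b::field"
begin

lemma denominator_dvd_numerator_power:
  assumes "x ^ n + (\<Sum>i<n. hom (c i) * x ^ i) = 0" and fraction: "hom b * x = hom a"
  shows "b dvd a ^ n"
proof -
  have scaled: "hom b ^ n * (hom (c i) * x ^ i) = hom (b * (c i * a ^ i * b ^ (n - i - 1)))"
    if "i < n" for i
  proof -
    have "hom b ^ n = hom b ^ i * hom b ^ Suc (n - i - 1)"
      using that by (subst power_add[symmetric]) simp
    then have "hom b ^ n * (hom (c i) * x ^ i) =
        hom b * (hom (c i) * (hom b * x) ^ i * hom b ^ (n - i - 1))"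
      by (simp add: power_mult_distrib mult_ac)
    then show ?thesis by (simp add: fraction hom_distribs)
  qed
  have "0 = hom b ^ n * (x ^ n + (\<Sum>i<n. hom (c i) * x ^ i))" by (simp add: assms(1))
  also have "\<dots> = (hom b * x) ^ n + (\<Sum>i<n. hom b ^ n * (hom (c i) * x ^ i))"
    by (simp add: distrib_left power_mult_distrib sum_distrib_left)
  also have "\<dots> = hom (a ^ n + b * (\<Sum>i<n. c i * a ^ i * b ^ (n - i - 1)))"
    by (simp add: fraction scaled sum_distrib_left hom_add hom_power hom_sum)
  finally have "a ^ n + b * (\<Sum>i<n. c i * a ^ i * b ^ (n - i - 1)) = 0" by (metis hom_0_iff)
  then have "a ^ n = b * (- (\<Sum>i<n. c i * a ^ i * b ^ (n - i - 1)))"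
    by (simp add: eq_neg_iff_add_eq_0)
  then show ?thesis by (rule dvdI)
qed

lemma integrally_closed:
  assumes x: "x \<in> integral_elements" and b: "b \<noteq> 0" and fraction: "hom b * x = hom a"
  obtains c where "x = hom c" "a = b * c"
proof -
  obtain u v d where d: "u * a + v * b = d" "d dvd a" "d dvd b"
    by (rule euclidean_ring_bezout)
  obtain a' b' where ab: "a = d * a'" "b = d * b'" using d(2,3) unfolding dvd_def by blast
  have "d \<noteq> 0" using b ab by auto
  have "d * (u * a' + v * b') = u * a + v * b" by (simp add: ab distrib_left mult_ac)
  also have "\<dots> = d * 1" using d(1) by simp
  finally have bezout: "u * a' + v * b' = 1" by (rule mult_left_cancel[OF \<open>d \<noteq> 0\<close>, THEN iffD1])
  have "hom d * (hom b' * x) = hom d * hom a'"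
    using fraction unfolding ab hom_mult by (simp only: mult.assoc)
  then have reduced: "hom b' * x = hom a'"
    using \<open>d \<noteq> 0\<close> by (metis hom_0_iff mult_left_cancel)
  obtain n c where "x ^ n + (\<Sum>i<n. hom (c i) * x ^ i) = 0"
    using x unfolding integral_elements_def by blast
  then have "b' dvd a' ^ n" using reduced by (rule denominator_dvd_numerator_power)
  with bezout have "b' dvd 1" by (rule dvd_one_if_dvd_power_bezout)
  then obtain e where e: "1 = b' * e" by (rule dvdE)
  have "x = hom (b' * e) * x" by (simp add: e[symmetric])
  also have "\<dots> = hom b' * x * hom e" by (simp add: hom_mult)
  also have "\<dots> = hom (a' * e)" by (simp add: reduced hom_mult)
  finally have "x = hom (a' * e)" .
  moreover have "a = b * (a' * e)" using arg_cong[OF e, of "\<lambda>t. a * t"] by (simp add: ab mult_ac)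
  ultimately show thesis by (rule that)
qed

end

section \<open>Extensions of the rational function field\<close>

lemma field_hom_iff: "field_hom f \<longleftrightarrow> Ring_Hom.field_hom f"
proof
  assume f: "field_hom f"
  have "f 0 + f 0 = f 0 + 0" using f unfolding Defs.field_hom_def by (metis add.right_neutral)
  then have "f 0 = 0" by (rule add_left_imp_eq)
  with f show "Ring_Hom.field_hom f" by unfold_locales (auto simp: Defs.field_hom_def)
next
  assume "Ring_Hom.field_hom f"
  then interpret Ring_Hom.field_hom f .
  show "field_hom f" by (simp add: Defs.field_hom_def hom_distribs)
qed

locale function_field_ext =
  fixes emb :: "'f::{finite,field} poly fract \<Rightarrow> 'k::field"
  assumes field_hom_emb: "field_hom emb"
begin

sublocale emb: Ring_Hom.field_hom emb
  using field_hom_emb by (simp add: field_hom_iff)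

abbreviation "\<iota> \<equiv> poly_emb emb"
abbreviation "\<O> \<equiv> ring_of_integers emb"

lemma euclidean_hom_to_field_poly_emb: "euclidean_hom_to_field \<iota>"
  by unfold_locales (simp_all add: poly_emb_def emb.hom_add emb.hom_mult)

sublocale \<iota>: euclidean_hom_to_field \<iota>
  rewrites "hom_to_field.integral_elements \<iota> = \<O>"
proof -
  show "euclidean_hom_to_field \<iota>" by (rule euclidean_hom_to_field_poly_emb)
  then interpret euclidean_hom_to_field \<iota> .
  show "hom_to_field.integral_elements \<iota> = \<O>"
    by (simp add: integral_elements_def ring_of_integers_def)
qed

sublocale \<O>: subring_set \<O>
  by (rule \<iota>.subring_set_integral_elements)

lemma poly_emb_in_base_field: "\<iota> a \<in> base_field emb"
  by (simp add: base_field_def poly_emb_def)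

lemma base_field_fraction:
  assumes "x \<in> base_field emb"
  obtains a b where "b \<noteq> 0" "\<iota> b * x = \<iota> a"
proof -
  obtain y where y: "x = emb y" using assms by (auto simp: base_field_def)
  obtain a b where ab: "y = Fract a b" "b \<noteq> 0" by (cases y) auto
  then have "to_fract b * y = to_fract a" by (simp add: to_fract_def eq_fract)
  then have "\<iota> b * x = \<iota> a" by (metis y emb.hom_mult poly_emb_def)
  with ab(2) show thesis by (rule that)
qed

lemma common_denominator:
  assumes "finite I" "\<And>i. i \<in> I \<Longrightarrow> c i \<in> base_field emb"
  obtains d where "d \<noteq> 0" "\<And>i. i \<in> I \<Longrightarrow> \<exists>a. \<iota> d * c i = \<iota> a"
proof -
  have "\<forall>i\<in>I. \<exists>a b. b \<noteq> 0 \<and> \<iota> b * c i = \<iota> a"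
    using assms(2) by (metis base_field_fraction)
  then obtain a b where ab: "\<And>i. i \<in> I \<Longrightarrow> b i \<noteq> 0" "\<And>i. i \<in> I \<Longrightarrow> \<iota> (b i) * c i = \<iota> (a i)"
    by metis
  show thesis
  proof
    show "prod b I \<noteq> 0" using assms(1) ab(1) by simp
    fix i assume i: "i \<in> I"
    have "\<iota> (prod b I) * c i = \<iota> (prod b (I - {i})) * (\<iota> (b i) * c i)"
      using prod.remove[OF assms(1) i, of b] by (simp add: \<iota>.hom_mult mult_ac)
    also have "\<dots> = \<iota> (prod b (I - {i}) * a i)" using ab(2)[OF i] by (simp add: \<iota>.hom_mult)
    finally show "\<exists>a. \<iota> (prod b I) * c i = \<iota> a" by blast
  qed
qed

lemma vector_space_emb: "vector_space (\<lambda>a x. emb a * x)"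
  by standard (simp_all add: emb.hom_add emb.hom_mult algebra_simps)

sublocale vs: vector_space "\<lambda>a x. emb a * x"
  by (rule vector_space_emb)

lemma is_basis_independentD:
  assumes "is_basis emb n b" "(\<Sum>i<n. emb (u i) * b i) = 0" "i < n"
  shows "u i = 0"
proof -
  have "emb (u i) = 0"
    using assms(1)[unfolded is_basis_def, THEN conjunct2, rule_format, of "\<lambda>i. emb (u i)"]
      assms(2,3)
    by (simp add: base_field_def)
  then show ?thesis by simp
qed

lemma is_basis_inj_on:
  assumes "is_basis emb n b"
  shows "inj_on b {..<n}"
proof (rule inj_onI, rule ccontr)
  fix i j assume ij: "i \<in> {..<n}" "j \<in> {..<n}" "b i = b j" "i \<noteq> j"
  define u :: "nat \<Rightarrow> 'f poly fract"
    where "u k = (if k = i then 1 else if k = j then - 1 else 0)" for k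
  have "(\<Sum>k<n. emb (u k) * b k) = (\<Sum>k\<in>{i, j}. emb (u k) * b k)"
    using ij by (intro sum.mono_neutral_right) (auto simp: u_def)
  also have "\<dots> = 0" using ij by (simp add: u_def emb.hom_uminus)
  finally have "u i = 0"
    using is_basis_independentD[OF assms] ij(1) by blast
  then show False by (simp add: u_def)
qed

lemma dim_eq_if_is_basis:
  assumes b: "is_basis emb n b"
  shows "vs.dim (UNIV :: 'k set) = n"
proof -
  note inj = is_basis_inj_on[OF b]
  have "vs.independent (b ` {..<n})"
  proof
    assume "vs.dependent (b ` {..<n})"
    then obtain u where u: "\<exists>v\<in>b ` {..<n}. u v \<noteq> 0" "(\<Sum>v\<in>b ` {..<n}. emb (u v) * v) = 0"
      using vs.dependent_finite[of "b ` {..<n}"] by auto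
    have "(\<Sum>i<n. emb (u (b i)) * b i) = 0" using u(2) inj by (simp add: sum.reindex)
    then show False using is_basis_independentD[OF b, of "\<lambda>i. u (b i)"] u(1) by auto
  qed
  moreover have "x \<in> vs.span (b ` {..<n})" for x
  proof -
    obtain c where c: "\<And>i. i < n \<Longrightarrow> c i \<in> range emb" "x = (\<Sum>i<n. c i * b i)"
      using b unfolding is_basis_def base_field_def by blast
    have "c i * b i \<in> vs.span (b ` {..<n})" if "i \<in> {..<n}" for i
      using c(1)[of i] that vs.span_scale[OF vs.span_base[of "b i" "b ` {..<n}"]] by auto
    then show ?thesis unfolding c(2) by (rule vs.span_sum)
  qed
  then have "vs.span (b ` {..<n}) = vs.span UNIV" by (metis UNIV_eq_I vs.span_UNIV)
  ultimately have "vs.dim UNIV = card (b ` {..<n})" using vs.dim_eq_card by blast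
  then show ?thesis using inj by (simp add: card_image)
qed

end

locale finite_function_field = function_field_ext emb
  for emb :: "'f::{finite,field} poly fract \<Rightarrow> 'k::field" +
  assumes finite_ext: "finite_ext emb"
begin

abbreviation "n \<equiv> ext_degree emb"

lemma is_basis_ext_basis: "is_basis emb n (ext_basis emb)"
proof -
  obtain m c where basis: "is_basis emb m c" using finite_ext by (auto simp: finite_ext_def)
  then have "n = m"
    unfolding ext_degree_def by (intro the_equality) (blast, metis dim_eq_if_is_basis)
  with basis show ?thesis unfolding ext_basis_def by (metis someI_ex)
qed

lemma coord_in_base_field: "i < n \<Longrightarrow> coord emb y i \<in> base_field emb"
  and sum_coord: "(\<Sum>i<n. coord emb y i * ext_basis emb i) = y"
proof -
  have "\<exists>c. (\<forall>i<n. c i \<in> base_field emb) \<and> y = (\<Sum>i<n. c i * ext_basis emb i)"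
    using is_basis_ext_basis unfolding is_basis_def by blast
  from someI_ex[OF this] show "i < n \<Longrightarrow> coord emb y i \<in> base_field emb"
    "(\<Sum>i<n. coord emb y i * ext_basis emb i) = y"
    unfolding coord_def by auto
qed

lemma ext_basis_nonzero_exists: obtains i where "i < n" "ext_basis emb i \<noteq> 0"
proof -
  have "\<exists>i<n. ext_basis emb i \<noteq> 0"
  proof (rule ccontr)
    assume "\<not> ?thesis"
    then have "(\<Sum>i<n. coord emb 1 i * ext_basis emb i) = 0" by simp
    then show False by (simp add: sum_coord)
  qed
  then show thesis using that by blast
qed

lemma integral_multiple_exists:
  obtains d where "d \<noteq> 0" "\<iota> d * y \<in> \<O>"
proof -
  let ?b = "ext_basis emb" and ?c = "\<lambda>(i, k). coord emb (y * ext_basis emb i) k"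
  obtain d where d: "d \<noteq> 0" "\<And>p. p \<in> {..<n} \<times> {..<n} \<Longrightarrow> \<exists>a. \<iota> d * ?c p = \<iota> a"
    by (rule common_denominator[of "{..<n} \<times> {..<n}" ?c]) (auto intro: coord_in_base_field)
  obtain i where i: "i < n" "?b i \<noteq> 0" by (rule ext_basis_nonzero_exists)
  have "\<iota> d * y \<in> \<O>"
  proof (rule \<iota>.integral_if_stable_span)
    show "finite (?b ` {..<n})" "?b i \<in> ?b ` {..<n}" "?b i \<noteq> 0" using i by auto
    fix s assume "s \<in> ?b ` {..<n}"
    then obtain i where i: "i < n" "s = ?b i" by auto
    have "\<iota> d * y * s = \<iota> d * (\<Sum>k<n. ?c (i, k) * ?b k)"
      unfolding i(2) by (simp add: sum_coord mult.assoc)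
    also have "\<dots> = (\<Sum>k<n. \<iota> d * ?c (i, k) * ?b k)"
      by (simp only: sum_distrib_left mult.assoc)
    also have "\<dots> \<in> \<iota>.scalars.span (?b ` {..<n})"
    proof (rule \<iota>.scalars.span_sum)
      fix k assume k: "k \<in> {..<n}"
      then obtain a where "\<iota> d * ?c (i, k) = \<iota> a" using d(2)[of "(i, k)"] i(1) by auto
      then show "\<iota> d * ?c (i, k) * ?b k \<in> \<iota>.scalars.span (?b ` {..<n})"
        using k by (auto intro: \<iota>.scalars.span_scale \<iota>.scalars.span_base)
    qed
    finally show "\<iota> d * y * s \<in> \<iota>.scalars.span (?b ` {..<n})" .
  qed
  with d(1) show thesis by (rule that)
qed

end

section \<open>Automorphisms and the trace\<close>

lemma characters_independent:
  fixes s :: "'i \<Rightarrow> 'a::monoid_mult \<Rightarrow> 'b::idom"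
  assumes "finite I" "inj_on s I"
    and "\<And>i. i \<in> I \<Longrightarrow> s i 1 = 1" "\<And>i x y. i \<in> I \<Longrightarrow> s i (x * y) = s i x * s i y"
    and "\<And>x. (\<Sum>i\<in>I. c i * s i x) = 0"
  shows "\<forall>i\<in>I. c i = 0"
  using assms
proof (induction I arbitrary: c rule: finite_induct)
  case (insert k I)
  have zero: "(\<Sum>i\<in>I. c i * (s i y - s k y) * s i x) = 0" for x y
  proof -
    have "0 = (\<Sum>i\<in>insert k I. c i * s i (y * x)) - s k y * (\<Sum>i\<in>insert k I. c i * s i x)"
      using insert.prems(4) by simp
    also have "\<dots> = (\<Sum>i\<in>insert k I. c i * (s i y - s k y) * s i x)"
      by (simp only: sum_distrib_left sum_subtractf[symmetric])
        (intro sum.cong refl, simp add: insert.prems(3) algebra_simps)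
    finally show ?thesis using insert.hyps by simp
  qed
  have others_zero: "c i = 0" if i: "i \<in> I" for i
  proof -
    have "s i \<noteq> s k" using insert.prems(1) insert.hyps(2) i by (metis inj_onD insert_iff)
    then obtain y where y: "s i y \<noteq> s k y" by blast
    have "\<forall>i\<in>I. c i * (s i y - s k y) = 0"
      by (rule insert.IH) (use insert.prems zero in \<open>auto simp: inj_on_insert\<close>)
    then show ?thesis using i y by (metis eq_iff_diff_eq_0 mult_eq_0_iff)
  qed
  moreover have "c k = 0"
    using insert.prems(4)[of 1] insert.hyps others_zero by (simp add: insert.prems(2))
  ultimately show ?case by blast
qed simp

locale galois_function_field = function_field_ext emb
  for emb :: "'f::{finite,field} poly fract \<Rightarrow> 'k::field" +
  assumes galois: "galois_ext emb"
begin

sublocale finite_function_field emb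
  by unfold_locales (use galois in \<open>simp add: galois_ext_def\<close>)

abbreviation "Gal \<equiv> ext_auts emb"

abbreviation "Gal_group \<equiv> \<lparr>carrier = Gal, monoid.mult = (\<circ>), one = id\<rparr>"

lemma card_Gal: "card Gal = n" and finite_Gal: "finite Gal"
  using galois by (auto simp: galois_ext_def)

lemma inv_in_Gal:
  assumes "s \<in> Gal"
  shows "inv_into UNIV s \<in> Gal"
proof -
  have bij: "bij s" and base: "\<And>x. x \<in> base_field emb \<Longrightarrow> s x = x"
    using assms by (auto simp: ext_auts_def)
  interpret s: Ring_Hom.field_hom s
    using assms by (simp add: ext_auts_def field_hom_iff)
  define t where "t = inv_into UNIV s"
  have inv: "s (t x) = x" "t (s x) = x" for x
    using bij by (simp_all add: t_def bij_def surj_f_inv_f)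
  have "t (x + y) = t x + t y" "t (x * y) = t x * t y" for x y
    by (metis s.hom_add inv) (metis s.hom_mult inv)
  moreover have "t 1 = 1" by (metis s.hom_one inv(2))
  moreover have "t x = x" if "x \<in> base_field emb" for x by (metis base[OF that] inv(2))
  ultimately have "t \<in> Gal"
    using bij by (simp add: ext_auts_def Defs.field_hom_def t_def bij_imp_bij_inv)
  then show ?thesis by (simp add: t_def)
qed

lemma group_Gal: "group Gal_group"
proof (rule groupI)
  fix s t assume "s \<in> carrier Gal_group" "t \<in> carrier Gal_group"
  then show "s \<otimes>\<^bsub>Gal_group\<^esub> t \<in> carrier Gal_group"
    by (auto simp: ext_auts_def Defs.field_hom_def intro: bij_comp)
next
  fix s assume s: "s \<in> carrier Gal_group"
  then have "inv_into UNIV s \<circ> s = id" by (auto simp: ext_auts_def bij_def)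
  then show "\<exists>t\<in>carrier Gal_group. t \<otimes>\<^bsub>Gal_group\<^esub> s = \<one>\<^bsub>Gal_group\<^esub>"
    using inv_in_Gal s by auto
qed (auto simp: ext_auts_def Defs.field_hom_def)

lemma funpow_degree_eq_id:
  assumes "s \<in> Gal"
  shows "s ^^ n = id"
proof -
  interpret group Gal_group by (rule group_Gal)
  have "s [^]\<^bsub>Gal_group\<^esub> (k::nat) = s ^^ k" for k
    by (induction k) (auto simp: funpow_Suc_right simp del: funpow.simps(2))
  then show ?thesis using pow_order_eq_1[of s] assms card_Gal by (simp add: order_def)
qed

text \<open>Values beyond the group order are automorphisms as well, so that \<open>aut j\<close> is
  unconditionally a homomorphism.\<close>
definition aut :: "nat \<Rightarrow> 'k \<Rightarrow> 'k" where
  "aut = (SOME f. bij_betw f {..<n} Gal \<and> range f \<subseteq> Gal)"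

lemma bij_betw_aut: "bij_betw aut {..<n} Gal" and aut_in_Gal: "aut j \<in> Gal"
proof -
  obtain f where f: "bij_betw f {..<n} Gal"
    using ex_bij_betw_nat_finite[OF finite_Gal] by (auto simp: card_Gal atLeast0LessThan)
  let ?f = "\<lambda>j. if j < n then f j else id"
  have "bij_betw ?f {..<n} Gal" using f bij_betw_cong[of "{..<n}" ?f f Gal] by simp
  moreover have "range ?f \<subseteq> Gal"
    using bij_betwE[OF f] by (auto simp: ext_auts_def Defs.field_hom_def)
  ultimately have "bij_betw aut {..<n} Gal \<and> range aut \<subseteq> Gal"
    unfolding aut_def by (intro someI_ex[of "\<lambda>f. bij_betw f {..<n} Gal \<and> range f \<subseteq> Gal"]) blast
  then show "bij_betw aut {..<n} Gal" "aut j \<in> Gal" by auto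
qed

sublocale aut: Ring_Hom.field_hom "aut j" for j
  using aut_in_Gal by (simp add: ext_auts_def field_hom_iff)

lemma aut_base: "x \<in> base_field emb \<Longrightarrow> aut j x = x"
  using aut_in_Gal by (auto simp: ext_auts_def)

lemma aut_poly_emb [simp]: "aut j (\<iota> a) = \<iota> a"
  by (rule aut_base) (rule poly_emb_in_base_field)

lemma aut_integral [intro]:
  assumes "x \<in> \<O>"
  shows "aut j x \<in> \<O>"
proof -
  obtain m a where a: "x ^ m + (\<Sum>i<m. \<iota> (a i) * x ^ i) = 0"
    using assms unfolding ring_of_integers_def by blast
  have "aut j x ^ m + (\<Sum>i<m. \<iota> (a i) * aut j x ^ i) = aut j (x ^ m + (\<Sum>i<m. \<iota> (a i) * x ^ i))"
    by (simp add: aut.hom_add aut.hom_power aut.hom_sum aut.hom_mult)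
  also have "\<dots> = 0" by (simp add: a)
  finally show ?thesis unfolding ring_of_integers_def by blast
qed

definition conj_det :: "(nat \<Rightarrow> 'k) \<Rightarrow> 'k" where
  "conj_det x = det_n n (\<lambda>i j. aut j (x i))"

lemma aut_eq_sum_coord: "aut j x = (\<Sum>i<n. coord emb x i * aut j (ext_basis emb i))"
proof -
  have "aut j x = aut j (\<Sum>i<n. coord emb x i * ext_basis emb i)" by (simp add: sum_coord)
  also have "\<dots> = (\<Sum>i<n. coord emb x i * aut j (ext_basis emb i))"
    by (simp add: aut.hom_sum aut.hom_mult aut_base coord_in_base_field)
  finally show ?thesis .
qed

lemma conj_det_ext_basis_nonzero: "conj_det (ext_basis emb) \<noteq> 0"
proof
  assume "conj_det (ext_basis emb) = 0"
  then obtain v where v: "\<exists>j<n. v j \<noteq> 0" "\<And>i. i < n \<Longrightarrow> (\<Sum>j<n. aut j (ext_basis emb i) * v j) = 0"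
    unfolding conj_det_def det_n_eq_0_iff by blast
  have "(\<Sum>j<n. v j * aut j x) = 0" for x
  proof -
    have "(\<Sum>j<n. v j * aut j x) = (\<Sum>j<n. \<Sum>i<n. coord emb x i * (aut j (ext_basis emb i) * v j))"
      by (subst aut_eq_sum_coord) (simp add: sum_distrib_left mult_ac)
    also have "\<dots> = (\<Sum>i<n. coord emb x i * (\<Sum>j<n. aut j (ext_basis emb i) * v j))"
      by (subst sum.swap) (simp add: sum_distrib_left)
    finally show ?thesis using v(2) by simp
  qed
  then have "\<forall>j\<in>{..<n}. v j = 0"
    using bij_betw_aut
    by (intro characters_independent[of _ aut]) (auto simp: bij_betw_def aut.hom_mult)
  then show False using v(1) by auto
qed

lemma ext_trace_eq_sum_aut: "ext_trace emb x = (\<Sum>j<n. aut j x)"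
  unfolding ext_trace_def
proof (rule trace_eq_sum_eigenvalues[where ev = "\<lambda>j. aut j x"
      and m = "\<lambda>i. coord emb (x * ext_basis emb i)" and B = "\<lambda>i j. aut j (ext_basis emb i)"])
  show "det_n n (\<lambda>i j. aut j (ext_basis emb i)) \<noteq> 0"
    using conj_det_ext_basis_nonzero by (simp add: conj_det_def)
  show "(\<Sum>k<n. coord emb (x * ext_basis emb i) k * aut j (ext_basis emb k))
      = aut j x * aut j (ext_basis emb i)" for i j
    by (simp add: aut_eq_sum_coord[symmetric] aut.hom_mult)
qed

lemma ext_trace_poly_combination:
  "ext_trace emb (\<Sum>i\<in>I. \<iota> (a i) * y i) = (\<Sum>i\<in>I. \<iota> (a i) * ext_trace emb (y i))"
proof -
  have "ext_trace emb (\<Sum>i\<in>I. \<iota> (a i) * y i) = (\<Sum>j<n. \<Sum>i\<in>I. \<iota> (a i) * aut j (y i))"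
    by (simp add: ext_trace_eq_sum_aut aut.hom_sum aut.hom_mult)
  also have "\<dots> = (\<Sum>i\<in>I. \<Sum>j<n. \<iota> (a i) * aut j (y i))" by (rule sum.swap)
  finally show ?thesis by (simp add: ext_trace_eq_sum_aut sum_distrib_left)
qed

lemma trace_form_nondegenerate:
  assumes "conj_det x \<noteq> 0" and "\<And>k. k < n \<Longrightarrow> ext_trace emb (x k * w) = 0"
  shows "w = 0"
proof -
  have "(\<Sum>j<n. aut j (x k) * aut j w) = 0" if "k < n" for k
    using assms(2)[OF that] by (simp add: ext_trace_eq_sum_aut aut.hom_mult)
  then have "aut j w = 0" if "j < n" for j
    using that by (rule det_n_nonzero_kernelD[OF assms(1)[unfolded conj_det_def], of "\<lambda>j. aut j w"])
  moreover have "0 < n" using ext_basis_nonzero_exists by (metis gr_implies_not0 gr0I)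
  ultimately show ?thesis by simp
qed

definition poly_trace :: "'k \<Rightarrow> 'f poly" where
  "poly_trace x = (SOME a. \<iota> a = ext_trace emb x)"

lemma poly_emb_poly_trace:
  assumes "x \<in> \<O>"
  shows "\<iota> (poly_trace x) = ext_trace emb x"
proof -
  have integral: "ext_trace emb x \<in> \<O>"
    unfolding ext_trace_eq_sum_aut using assms by (intro \<O>.sum_closed aut_integral)
  have "\<forall>i<n. \<exists>e. coord emb (x * ext_basis emb i) i = emb e"
    using coord_in_base_field by (auto simp: base_field_def)
  then obtain e where "\<And>i. i < n \<Longrightarrow> coord emb (x * ext_basis emb i) i = emb (e i)" by metis
  then have "ext_trace emb x = emb (\<Sum>i<n. e i)" by (simp add: ext_trace_def emb.hom_sum)
  then have "ext_trace emb x \<in> base_field emb" by (simp add: base_field_def)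
  then obtain a b where "b \<noteq> 0" "\<iota> b * ext_trace emb x = \<iota> a" by (rule base_field_fraction)
  with integral obtain c where "ext_trace emb x = \<iota> c" by (rule \<iota>.integrally_closed)
  then have "\<exists>a. \<iota> a = ext_trace emb x" by metis
  then show ?thesis unfolding poly_trace_def by (rule someI_ex)
qed

section \<open>Discriminants and integral bases\<close>

definition disc :: "(nat \<Rightarrow> 'k) \<Rightarrow> 'f poly" where
  "disc x = det_n n (\<lambda>i j. poly_trace (x i * x j))"

abbreviation integral_family :: "(nat \<Rightarrow> 'k) \<Rightarrow> bool" where
  "integral_family x \<equiv> \<forall>i<n. x i \<in> \<O>"

definition integral_basis :: "(nat \<Rightarrow> 'k) \<Rightarrow> bool" where
  "integral_basis x \<longleftrightarrow> integral_family x \<and> disc x \<noteq> 0 \<and>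
     (\<forall>y\<in>\<O>. \<exists>c. y = (\<Sum>i<n. \<iota> (c i) * x i))"

lemma poly_emb_disc:
  assumes "integral_family x"
  shows "\<iota> (disc x) = det_n n (\<lambda>i j. ext_trace emb (x i * x j))"
  unfolding disc_def \<iota>.hom_det_n
  using assms by (intro det_n_cong) (simp add: poly_emb_poly_trace \<O>.mult_closed)

lemma poly_emb_disc_eq_square:
  assumes "integral_family x"
  shows "\<iota> (disc x) = (conj_det x)\<^sup>2"
proof -
  have "\<iota> (disc x) = det_n n (\<lambda>i j. \<Sum>k<n. aut k (x i) * aut k (x j))"
    unfolding poly_emb_disc[OF assms] by (simp add: ext_trace_eq_sum_aut aut.hom_mult)
  also have "\<dots> = conj_det x * det_n n (\<lambda>i j. aut i (x j))"
    unfolding conj_det_def by (rule det_n_mult)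
  also have "\<dots> = (conj_det x)\<^sup>2"
    by (simp add: conj_det_def det_n_transpose[of n "\<lambda>i j. aut j (x i)"] power2_eq_square)
  finally show ?thesis .
qed

lemma conj_det_nonzero_iff: "integral_family x \<Longrightarrow> conj_det x \<noteq> 0 \<longleftrightarrow> disc x \<noteq> 0"
  using poly_emb_disc_eq_square[of x] by (metis \<iota>.hom_0_iff zero_eq_power2)

lemma disc_dvd_disc_combination:
  assumes x: "integral_family x" and z: "\<And>i. i < n \<Longrightarrow> z i = (\<Sum>k<n. \<iota> (C i k) * x k)"
  shows "disc x dvd disc z"
proof -
  have "integral_family z" using x z by (auto intro!: \<O>.sum_closed)
  moreover have "conj_det z = det_n n (\<lambda>i j. \<Sum>k<n. \<iota> (C i k) * aut j (x k))"
    unfolding conj_det_def by (rule det_n_cong) (simp add: z aut.hom_sum aut.hom_mult)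
  then have "conj_det z = \<iota> (det_n n C) * conj_det x"
    by (simp add: det_n_mult conj_det_def \<iota>.hom_det_n)
  ultimately have "\<iota> (disc z) = \<iota> ((det_n n C)\<^sup>2 * disc x)"
    using x by (simp add: poly_emb_disc_eq_square power_mult_distrib \<iota>.hom_mult \<iota>.hom_power)
  then show ?thesis by simp
qed

lemma disc_update_combination:
  assumes x: "integral_family x" and z: "z \<in> \<O>" and i: "i < n"
    and combination: "\<iota> c * z = (\<Sum>k<n. \<iota> (r k) * x k)"
  shows "c\<^sup>2 * disc (x(i := z)) = (r i)\<^sup>2 * disc x"
proof -
  let ?X = "\<lambda>i j. aut j (x i)"
  have "\<iota> c * det_n n (?X(i := \<lambda>j. aut j z)) = \<iota> (r i) * det_n n ?X"
    using i
  proof (rule det_n_update_row_eq[where r = "\<lambda>k. \<iota> (r k)"])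
    show "\<iota> c * aut j z = (\<Sum>k<n. \<iota> (r k) * aut j (x k))" for j
      using arg_cong[OF combination, of "aut j"] by (simp add: aut.hom_sum aut.hom_mult)
  qed
  moreover have "conj_det (x(i := z)) = det_n n (?X(i := \<lambda>j. aut j z))"
    unfolding conj_det_def by (rule det_n_cong) simp
  ultimately have "\<iota> c * conj_det (x(i := z)) = \<iota> (r i) * conj_det x"
    by (simp add: conj_det_def)
  then have "(\<iota> c * conj_det (x(i := z)))\<^sup>2 = (\<iota> (r i) * conj_det x)\<^sup>2" by simp
  moreover have "integral_family (x(i := z))" using x z by simp
  ultimately have "\<iota> (c\<^sup>2 * disc (x(i := z))) = \<iota> ((r i)\<^sup>2 * disc x)"
    using x by (simp add: poly_emb_disc_eq_square power_mult_distrib \<iota>.hom_mult \<iota>.hom_power)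
  then show ?thesis by simp
qed

lemma disc_mult_integral_combination:
  assumes x: "integral_family x" "disc x \<noteq> 0" and y: "y \<in> \<O>"
  obtains a where "\<iota> (disc x) * y = (\<Sum>i<n. \<iota> (a i) * x i)"
proof
  define M where "M i j = poly_trace (x i * x j)" for i j
  define a where "a i = (\<Sum>j<n. adj_n n M i j * poly_trace (x j * y))" for i
  have trace: "ext_trace emb (x k * (\<Sum>i<n. \<iota> (a i) * x i)) = ext_trace emb (x k * (\<iota> (disc x) * y))"
    if k: "k < n" for k
  proof -
    have "x k * (\<Sum>i<n. \<iota> (a i) * x i) = (\<Sum>i<n. \<iota> (a i) * (x k * x i))"
      by (simp add: sum_distrib_left mult_ac)
    then have "ext_trace emb (x k * (\<Sum>i<n. \<iota> (a i) * x i)) = (\<Sum>i<n. \<iota> (a i) * \<iota> (M k i))"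
      using x(1) k by (simp add: ext_trace_poly_combination M_def poly_emb_poly_trace \<O>.mult_closed)
    also have "\<dots> = \<iota> (\<Sum>i<n. M k i * a i)" by (simp add: \<iota>.hom_sum \<iota>.hom_mult mult.commute)
    also have "(\<Sum>i<n. M k i * a i) = disc x * poly_trace (x k * y)"
      using mat_mult_adj_n_apply[OF k, of M "\<lambda>j. poly_trace (x j * y)"]
      by (simp add: a_def disc_def M_def[abs_def])
    also have "\<iota> \<dots> = \<iota> (disc x) * ext_trace emb (x k * y)"
      using x(1) k y by (simp add: \<iota>.hom_mult poly_emb_poly_trace \<O>.mult_closed)
    also have "\<dots> = ext_trace emb (x k * (\<iota> (disc x) * y))"
      using ext_trace_poly_combination[of "\<lambda>_. disc x" "\<lambda>_. x k * y" "{0::nat}"]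
      by (simp add: mult_ac)
    finally show ?thesis .
  qed
  have "(\<Sum>i<n. \<iota> (a i) * x i) - \<iota> (disc x) * y = 0"
  proof (rule trace_form_nondegenerate)
    show "conj_det x \<noteq> 0" using x conj_det_nonzero_iff by blast
    show "ext_trace emb (x k * ((\<Sum>i<n. \<iota> (a i) * x i) - \<iota> (disc x) * y)) = 0" if "k < n" for k
      using trace[OF that]
      by (simp add: right_diff_distrib ext_trace_eq_sum_aut aut.hom_minus sum_subtractf)
  qed
  then show "\<iota> (disc x) * y = (\<Sum>i<n. \<iota> (a i) * x i)" by simp
qed

lemma integral_family_disc_nonzero_exists:
  obtains x where "integral_family x" "disc x \<noteq> 0"
proof -
  have "\<forall>i. \<exists>d. d \<noteq> 0 \<and> \<iota> d * ext_basis emb i \<in> \<O>" by (metis integral_multiple_exists)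
  then obtain d where d: "\<And>i. d i \<noteq> 0" "\<And>i. \<iota> (d i) * ext_basis emb i \<in> \<O>" by metis
  let ?x = "\<lambda>i. \<iota> (d i) * ext_basis emb i"
  have "conj_det ?x = (\<Prod>i<n. \<iota> (d i)) * conj_det (ext_basis emb)"
    by (simp add: conj_det_def aut.hom_mult det_n_scale_rows)
  then have "conj_det ?x \<noteq> 0" using d(1) conj_det_ext_basis_nonzero by simp
  then show thesis using that[of ?x] d(2) conj_det_nonzero_iff[of ?x] by blast
qed

lemma disc_update_remainder:
  assumes x: "integral_family x" "disc x \<noteq> 0" and z: "z \<in> \<O>" and i: "i < n"
    and combination: "\<iota> (disc x) * z = (\<Sum>k<n. \<iota> (r k) * x k)"
    and r: "r i \<noteq> 0" "degree (r i) < degree (disc x)"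
  shows "disc (x(i := z)) \<noteq> 0" "degree (disc (x(i := z))) < degree (disc x)"
proof -
  have "(disc x)\<^sup>2 * disc (x(i := z)) = (r i)\<^sup>2 * disc x"
    using x(1) z i combination by (rule disc_update_combination)
  then have square: "disc x * disc (x(i := z)) = (r i)\<^sup>2" using x(2) by (simp add: power2_eq_square)
  then show nonzero: "disc (x(i := z)) \<noteq> 0" using r(1) by auto
  have "degree (disc x) + degree (disc (x(i := z))) = 2 * degree (r i)"
    using arg_cong[OF square, of degree] x(2) nonzero r(1)
    by (simp add: degree_mult_eq degree_power_eq)
  then show "degree (disc (x(i := z))) < degree (disc x)" using r(2) by simp
qed

text \<open>An integral family whose discriminant has minimal degree is a basis: a non-integral
  coefficient would leave a remainder on division by the discriminant, and exchanging the
  corresponding element into the family would multiply the discriminant by the square of a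
  proper fraction.\<close>
theorem integral_basis_exists:
  obtains x where "integral_basis x"
proof -
  obtain x where x: "integral_family x" "disc x \<noteq> 0"
    and minimal: "\<And>z. integral_family z \<Longrightarrow> disc z \<noteq> 0 \<Longrightarrow> degree (disc x) \<le> degree (disc z)"
    using ex_has_least_nat[of "\<lambda>x. integral_family x \<and> disc x \<noteq> 0" _ "\<lambda>x. degree (disc x)"]
      integral_family_disc_nonzero_exists by metis
  let ?d = "disc x"
  have "\<exists>c. y = (\<Sum>i<n. \<iota> (c i) * x i)" if y: "y \<in> \<O>" for y
  proof -
    obtain a where a: "\<iota> ?d * y = (\<Sum>i<n. \<iota> (a i) * x i)"
      using disc_mult_integral_combination[OF x y] .
    define z where "z = y - (\<Sum>i<n. \<iota> (a i div ?d) * x i)"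
    have z: "z \<in> \<O>" unfolding z_def using x(1) y by (intro \<O>.diff_closed \<O>.sum_closed) auto
    have remainder: "\<iota> ?d * z = (\<Sum>i<n. \<iota> (a i mod ?d) * x i)"
      unfolding z_def right_diff_distrib a minus_mult_div_eq_mod[symmetric]
      by (simp add: sum_distrib_left sum_subtractf[symmetric] \<iota>.hom_minus \<iota>.hom_mult algebra_simps)
    have "a i mod ?d = 0" if i: "i < n" for i
    proof (rule ccontr)
      assume nonzero: "a i mod ?d \<noteq> 0"
      then have "degree (a i mod ?d) < degree ?d" using degree_mod_less[OF x(2), of "a i"] by simp
      note smaller = disc_update_remainder[OF x z i remainder nonzero this]
      have "integral_family (x(i := z))" using x(1) z by simp
      with smaller show False using minimal by (meson leD)
    qed
    then have "\<iota> ?d * z = 0" by (simp add: remainder)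
    then show ?thesis using x(2) by (auto simp: z_def)
  qed
  then have "integral_basis x" using x by (simp add: integral_basis_def)
  then show thesis by (rule that)
qed

lemma integral_basis_independent:
  assumes x: "integral_basis x" and zero: "(\<Sum>i<n. \<iota> (c i) * x i) = 0" and i: "i < n"
  shows "c i = 0"
proof -
  have "(\<Sum>i<n. aut j (x i) * \<iota> (c i)) = 0" for j
    using arg_cong[OF zero, of "aut j"] by (simp add: aut.hom_sum aut.hom_mult mult.commute)
  moreover have "det_n n (\<lambda>i j. aut i (x j)) \<noteq> 0"
    using x conj_det_nonzero_iff[of x] det_n_transpose[of n "\<lambda>i j. aut j (x i)"]
    by (simp add: conj_det_def integral_basis_def)
  ultimately have "\<iota> (c i) = 0"
    using det_n_nonzero_kernelD[of n "\<lambda>i j. aut i (x j)" "\<lambda>i. \<iota> (c i)" i] i by simp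
  then show ?thesis by simp
qed

lemma disc_coprime_if_integral_basis:
  assumes x: "integral_basis x" and coprime: "rel_prime_ideal (discriminant_ideal emb) g"
  obtains u v where "u * disc x + v * g = 1"
proof (rule bezout_one_if_no_common_irreducible_factor)
  show "disc x \<noteq> 0" using x by (simp add: integral_basis_def)
  fix p assume p: "irreducible p" "p dvd g"
  show "\<not> p dvd disc x"
  proof
    assume "p dvd disc x"
    have "discriminant_ideal emb \<subseteq> UNIV.principal_ideal p"
      unfolding discriminant_ideal_def poly_ring_def
    proof (rule UNIV.struct.genideal_minimal[OF UNIV.ideal_principal_ideal], simp, clarify)
      fix d z
      assume "integral_family z" "\<iota> d = det_n n (\<lambda>i j. ext_trace emb (z i * z j))"
      then have "d = disc z" by (simp add: poly_emb_disc[symmetric])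
      moreover have "\<forall>i. \<exists>c. i < n \<longrightarrow> z i = (\<Sum>k<n. \<iota> (c k) * x k)"
        using x \<open>integral_family z\<close> unfolding integral_basis_def by blast
      then obtain C where "\<And>i. i < n \<Longrightarrow> z i = (\<Sum>k<n. \<iota> (C i k) * x k)" by metis
      ultimately have "p dvd d"
        using \<open>p dvd disc x\<close> x disc_dvd_disc_combination[of x z C] dvd_trans
        by (auto simp: integral_basis_def)
      then show "d \<in> UNIV.principal_ideal p" by (auto simp: UNIV.principal_ideal_eq elim: dvdE)
    qed
    then have "\<forall>d\<in>discriminant_ideal emb. p dvd d" by (auto simp: UNIV.principal_ideal_eq)
    then show False using coprime p unfolding rel_prime_ideal_def by blast
  qed
qed (rule that)

end

section \<open>Quotients of the ring of integers\<close>

lemma bij_betw_mod_quotient: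
  fixes g :: "'a::euclidean_ring_cancel"
  shows "bij_betw (UNIV.residue g) (range (\<lambda>a. a mod g)) (carrier (UNIV.quotient_by g))"
proof (rule UNIV.bij_betw_quotient)
  show "\<exists>r\<in>range (\<lambda>a. a mod g). UNIV.cong_mod g a r" for a
    by (intro bexI[of _ "a mod g"]) (auto simp: cong_mod_UNIV_iff minus_mod_eq_mult_div)
  show "r = s" if "r \<in> range (\<lambda>a. a mod g)" "s \<in> range (\<lambda>a. a mod g)" "UNIV.cong_mod g r s" for r s
    using that by (auto simp: cong_mod_UNIV_iff mod_eq_dvd_iff[symmetric])
qed auto

context function_field_ext
begin

lemma cong_mod_poly_emb_iff: "\<O>.cong_mod (\<iota> g) (\<iota> a) (\<iota> b) \<longleftrightarrow> g dvd a - b"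
proof
  assume "\<O>.cong_mod (\<iota> g) (\<iota> a) (\<iota> b)"
  then obtain z where z: "z \<in> \<O>" "\<iota> g * z = \<iota> (a - b)"
    unfolding \<O>.cong_mod_def by (metis \<iota>.hom_minus)
  show "g dvd a - b"
  proof (cases "g = 0")
    case True
    then have "\<iota> (a - b) = 0" using z(2)[symmetric] by simp
    then show ?thesis unfolding \<iota>.hom_0_iff by simp
  next
    case False
    then show ?thesis by (rule \<iota>.integrally_closed[OF z(1) _ z(2)]) (rule dvdI)
  qed
next
  assume "g dvd a - b"
  then obtain c where "a - b = g * c" by (rule dvdE)
  then have "\<iota> a - \<iota> b = \<iota> g * \<iota> c" by (metis \<iota>.hom_minus \<iota>.hom_mult)
  then show "\<O>.cong_mod (\<iota> g) (\<iota> a) (\<iota> b)" unfolding \<O>.cong_mod_def by auto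
qed

lemma poly_emb_ring_hom: "ring_hom_ring (subring_struct UNIV) (subring_struct \<O>) \<iota>"
  by (rule ring_hom_ringI[OF UNIV.struct.ring_axioms \<O>.struct.ring_axioms])
    (auto simp: subring_struct_def \<iota>.hom_add \<iota>.hom_mult)

lemma poly_emb_vimage_principal_ideal:
  "{a \<in> carrier (subring_struct UNIV). \<iota> a \<in> \<O>.principal_ideal (\<iota> g)} = UNIV.principal_ideal g"
proof -
  have "\<iota> a \<in> \<O>.principal_ideal (\<iota> g) \<longleftrightarrow> a \<in> UNIV.principal_ideal g" for a
    using cong_mod_poly_emb_iff[of g a 0]
    by (auto simp: \<O>.principal_ideal_eq UNIV.principal_ideal_eq \<O>.cong_mod_def dvd_def)
  then show ?thesis by simp
qed

lemma field_poly_quotient_if_field_integral_quotient: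
  assumes "finite (carrier (UNIV.quotient_by g))" "field (\<O>.quotient_by (\<iota> g))"
  shows "field (UNIV.quotient_by g)"
  using ring_hom_ring.field_quotient_vimage_if_finite[OF poly_emb_ring_hom UNIV.cring_subring_struct
      \<O>.cring_subring_struct \<O>.ideal_principal_ideal[OF \<iota>.hom_integral]] assms
  unfolding poly_emb_vimage_principal_ideal by blast

lemma prime_CHAR: "prime CHAR('k)"
proof -
  have "of_nat CHAR('f) = (0 :: 'f poly)" using of_nat_CHAR[where 'a = "'f poly"] by simp
  then have "of_nat CHAR('f) = (0 :: 'k)" by (metis \<iota>.hom_of_nat \<iota>.hom_zero)
  then have "CHAR('k) dvd CHAR('f)" by (simp add: of_nat_eq_0_iff_char_dvd)
  moreover have "CHAR('f) > 0" by (rule finite_imp_CHAR_pos) simp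
  ultimately have "CHAR('k) > 0" by (auto intro: gr0I)
  then show ?thesis by (rule prime_CHAR_semidom)
qed

lemma card_poly_quotient_eq_CHAR_power:
  assumes "finite (carrier (UNIV.quotient_by (g :: 'f poly)))"
  obtains m where "card (carrier (UNIV.quotient_by g)) = CHAR('k) ^ m"
proof -
  have "of_nat CHAR('k) = (0 :: 'f poly)" by (metis \<iota>.hom_of_nat \<iota>.hom_0_iff of_nat_CHAR)
  then show thesis
    using UNIV.card_quotient_prime_power[OF UNIV_I assms prime_CHAR] that by blast
qed

end

context galois_function_field
begin

lemma integral_basis_cong_unique:
  assumes x: "integral_basis x"
    and cong: "\<O>.cong_mod (\<iota> g) (\<Sum>i<n. \<iota> (r i) * x i) (\<Sum>i<n. \<iota> (s i) * x i)" and i: "i < n"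
  shows "g dvd r i - s i"
proof -
  obtain z where z: "z \<in> \<O>" "(\<Sum>i<n. \<iota> (r i) * x i) - (\<Sum>i<n. \<iota> (s i) * x i) = \<iota> g * z"
    using cong unfolding \<O>.cong_mod_def by blast
  obtain c where c: "z = (\<Sum>i<n. \<iota> (c i) * x i)"
    using x z(1) unfolding integral_basis_def by blast
  have "(\<Sum>i<n. \<iota> (r i - s i - g * c i) * x i)
      = (\<Sum>i<n. \<iota> (r i) * x i) - (\<Sum>i<n. \<iota> (s i) * x i) - \<iota> g * z"
    by (simp only: c \<iota>.hom_minus \<iota>.hom_mult left_diff_distrib mult.assoc sum_subtractf
        sum_distrib_left)
  also have "\<dots> = 0" by (simp add: z(2))
  finally have "r i - s i - g * c i = 0"
    using integral_basis_independent[OF x _ i, of "\<lambda>i. r i - s i - g * c i"] by simp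
  then show ?thesis by simp
qed

lemma bij_betw_integral_basis_quotient:
  assumes x: "integral_basis x"
  shows "bij_betw (\<lambda>r. \<O>.residue (\<iota> g) (\<Sum>i<n. \<iota> (r i) * x i))
    ({..<n} \<rightarrow>\<^sub>E range (\<lambda>a. a mod g)) (carrier (\<O>.quotient_by (\<iota> g)))"
proof (rule \<O>.bij_betw_quotient[OF \<iota>.hom_integral])
  have x_integral: "x i \<in> \<O>" if "i < n" for i using x that by (simp add: integral_basis_def)
  show "(\<lambda>r. \<Sum>i<n. \<iota> (r i) * x i) ` ({..<n} \<rightarrow>\<^sub>E range (\<lambda>a. a mod g)) \<subseteq> \<O>"
    using x_integral by (auto intro!: \<O>.sum_closed)
  show "\<exists>r\<in>{..<n} \<rightarrow>\<^sub>E range (\<lambda>a. a mod g). \<O>.cong_mod (\<iota> g) y (\<Sum>i<n. \<iota> (r i) * x i)"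
    if y: "y \<in> \<O>" for y
  proof -
    obtain c where c: "y = (\<Sum>i<n. \<iota> (c i) * x i)" using x y unfolding integral_basis_def by blast
    let ?r = "\<lambda>i\<in>{..<n}. c i mod g"
    have "\<O>.cong_mod (\<iota> g) y (\<Sum>i<n. \<iota> (?r i) * x i)"
      unfolding c by (intro \<O>.cong_mod_sum \<O>.cong_mod_mult_right)
        (auto simp: cong_mod_poly_emb_iff minus_mod_eq_mult_div x_integral)
    moreover have "?r \<in> {..<n} \<rightarrow>\<^sub>E range (\<lambda>a. a mod g)" by auto
    ultimately show ?thesis by blast
  qed
  show "r = s"
    if rs: "r \<in> {..<n} \<rightarrow>\<^sub>E range (\<lambda>a. a mod g)" "s \<in> {..<n} \<rightarrow>\<^sub>E range (\<lambda>a. a mod g)"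
      and cong: "\<O>.cong_mod (\<iota> g) (\<Sum>i<n. \<iota> (r i) * x i) (\<Sum>i<n. \<iota> (s i) * x i)" for r s
  proof (rule PiE_ext[OF rs])
    fix i assume i: "i \<in> {..<n}"
    then have "g dvd r i - s i" using integral_basis_cong_unique[OF x cong] by simp
    moreover obtain a b where "r i = a mod g" "s i = b mod g"
      using PiE_mem[OF rs(1) i] PiE_mem[OF rs(2) i] by blast
    ultimately show "r i = s i" by (simp add: mod_eq_dvd_iff[symmetric])
  qed
qed

lemma card_integral_quotient:
  assumes fin: "finite (carrier (UNIV.quotient_by g))"
  shows "finite (carrier (\<O>.quotient_by (\<iota> g)))"
    and "card (carrier (\<O>.quotient_by (\<iota> g))) = card (carrier (UNIV.quotient_by g)) ^ n"
proof -
  let ?R = "range (\<lambda>a. a mod g)"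
  obtain x where x: "integral_basis x" by (rule integral_basis_exists)
  note bij = bij_betw_mod_quotient[of g] bij_betw_integral_basis_quotient[OF x, of g]
  have "finite ?R" and card_R: "card ?R = card (carrier (UNIV.quotient_by g))"
    using bij_betw_finite[OF bij(1)] bij_betw_same_card[OF bij(1)] fin by simp_all
  then show "finite (carrier (\<O>.quotient_by (\<iota> g)))"
    using bij_betw_finite[OF bij(2)] by (simp add: finite_PiE)
  show "card (carrier (\<O>.quotient_by (\<iota> g))) = card (carrier (UNIV.quotient_by g)) ^ n"
    using bij_betw_same_card[OF bij(2)] by (simp add: card_PiE card_R)
qed

end

section \<open>The power map modulo a polynomial prime to the discriminant\<close>

locale coprime_discriminant = galois_function_field emb
  for emb :: "'f::{finite,field} poly fract \<Rightarrow> 'k::field" +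
  fixes g :: "'f poly" and x :: "nat \<Rightarrow> 'k" and u v :: "'f poly"
  assumes basis: "integral_basis x" and disc_bezout: "u * disc x + v * g = 1"
begin

abbreviation cong_g :: "'k \<Rightarrow> 'k \<Rightarrow> bool"  (infix \<open>\<approx>\<close> 50) where
  "y \<approx> z \<equiv> \<O>.cong_mod (\<iota> g) y z"

lemma basis_integral: "i < n \<Longrightarrow> x i \<in> \<O>"
  using basis by (simp add: integral_basis_def)

abbreviation conj_mat :: "nat \<Rightarrow> nat \<Rightarrow> 'k" where
  "conj_mat i j \<equiv> aut j (x i)"

lemma adj_conj_mat_integral: "i < n \<Longrightarrow> j < n \<Longrightarrow> adj_n n conj_mat i j \<in> \<O>"
  by (rule \<O>.adj_n_closed) (auto intro: basis_integral)

lemma conj_det_integral: "conj_det x \<in> \<O>"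
  unfolding conj_det_def by (rule \<O>.det_n_closed) (auto intro: basis_integral)

lemma conj_det_unit: "\<iota> u * conj_det x * det_n n conj_mat \<approx> 1"
proof -
  have "\<iota> u * conj_det x * det_n n conj_mat = \<iota> (u * disc x)"
    using basis
    by (simp add: integral_basis_def conj_det_def[symmetric] poly_emb_disc_eq_square
        \<iota>.hom_mult power2_eq_square)
  moreover have "u * disc x - 1 = g * (- v)"
    using disc_bezout by (simp add: algebra_simps eq_neg_iff_add_eq_0)
  then have "\<iota> (u * disc x) \<approx> \<iota> 1" unfolding cong_mod_poly_emb_iff by simp
  ultimately show ?thesis by simp
qed

lemma conj_mat_cancel:
  assumes w: "\<And>j. j < n \<Longrightarrow> w j \<in> \<O>"
    and zero: "\<And>k. k < n \<Longrightarrow> (\<Sum>j<n. conj_mat k j * w j) \<approx> 0" and j: "j < n"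
  shows "w j \<approx> 0"
proof -
  have "w j \<approx> \<iota> u * conj_det x * (\<Sum>k<n. adj_n n conj_mat j k * (\<Sum>i<n. conj_mat k i * w i))"
    using \<O>.adj_n_mult_mat_cong[of "\<iota> g" _ n conj_mat j w, OF conj_det_unit j w[OF j]]
    by (rule \<O>.cong_mod_sym)
  also have "\<dots> \<approx> \<iota> u * conj_det x * (\<Sum>k<n. adj_n n conj_mat j k * 0)"
    using zero j
    by (intro \<O>.cong_mod_mult_left \<O>.cong_mod_sum \<O>.mult_closed \<iota>.hom_integral conj_det_integral
        adj_conj_mat_integral) auto
  finally show ?thesis by simp
qed

lemma linear_map_aut_combination:
  assumes closed: "\<And>i. i < n \<Longrightarrow> \<phi> (x i) \<in> \<O>"
    and linear: "\<And>a. \<phi> (\<Sum>i<n. \<iota> (a i) * x i) \<approx> (\<Sum>i<n. \<iota> (a i) * \<phi> (x i))"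
  obtains c where "\<And>j. j < n \<Longrightarrow> c j \<in> \<O>" "\<And>y. y \<in> \<O> \<Longrightarrow> \<phi> y \<approx> (\<Sum>j<n. c j * aut j y)"
proof -
  define c where "c j = \<iota> u * conj_det x * (\<Sum>k<n. adj_n n conj_mat j k * \<phi> (x k))" for j
  have on_basis: "(\<Sum>j<n. conj_mat i j * c j) \<approx> \<phi> (x i)" if "i < n" for i
    unfolding c_def
    by (rule \<O>.mat_mult_adj_n_cong[of "\<iota> g" _ n conj_mat i "\<lambda>i. \<phi> (x i)"])
      (simp_all add: that closed conj_det_unit)
  show thesis
  proof
    show "c j \<in> \<O>" if "j < n" for j
      unfolding c_def using that closed
      by (auto intro!: \<O>.mult_closed \<O>.sum_closed conj_det_integral adj_conj_mat_integral)
    fix y assume "y \<in> \<O>"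
    then obtain a where a: "y = (\<Sum>i<n. \<iota> (a i) * x i)"
      using basis unfolding integral_basis_def by blast
    have "\<phi> y \<approx> (\<Sum>i<n. \<iota> (a i) * \<phi> (x i))" unfolding a by (rule linear)
    also have "\<dots> \<approx> (\<Sum>i<n. \<iota> (a i) * (\<Sum>j<n. conj_mat i j * c j))"
      by (intro \<O>.cong_mod_sum \<O>.cong_mod_mult_left \<iota>.hom_integral \<O>.cong_mod_sym[OF on_basis]) auto
    also have "\<dots> = (\<Sum>i<n. \<Sum>j<n. c j * (\<iota> (a i) * aut j (x i)))"
      by (simp add: sum_distrib_left mult_ac)
    also have "\<dots> = (\<Sum>j<n. \<Sum>i<n. c j * (\<iota> (a i) * aut j (x i)))" by (rule sum.swap)
    also have "\<dots> = (\<Sum>j<n. c j * aut j y)"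
      by (simp add: a aut.hom_sum aut.hom_mult sum_distrib_left)
    finally show "\<phi> y \<approx> (\<Sum>j<n. c j * aut j y)" .
  qed
qed

lemma multiplicative_map_coefficient:
  assumes closed: "\<And>y. y \<in> \<O> \<Longrightarrow> \<phi> y \<in> \<O>"
    and mult: "\<And>y z. y \<in> \<O> \<Longrightarrow> z \<in> \<O> \<Longrightarrow> \<phi> (y * z) = \<phi> y * \<phi> z"
    and c: "\<And>j. j < n \<Longrightarrow> c j \<in> \<O>"
    and expansion: "\<And>y. y \<in> \<O> \<Longrightarrow> \<phi> y \<approx> (\<Sum>j<n. c j * aut j y)"
    and z: "z \<in> \<O>" and j: "j < n"
  shows "c j * \<phi> z \<approx> c j * aut j z"
proof -
  have "c j * (aut j z - \<phi> z) \<approx> 0"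
  proof (rule conj_mat_cancel[where w = "\<lambda>j. c j * (aut j z - \<phi> z)"])
    show "c j * (aut j z - \<phi> z) \<in> \<O>" if "j < n" for j
      using c[OF that] closed[OF z] z by blast
    fix k assume k: "k < n"
    have "(\<Sum>j<n. conj_mat k j * (c j * aut j z)) = (\<Sum>j<n. c j * aut j (z * x k))"
      by (simp add: aut.hom_mult mult_ac)
    also have "\<dots> \<approx> \<phi> (z * x k)"
      using k by (intro \<O>.cong_mod_sym[OF expansion] \<O>.mult_closed z basis_integral)
    also have "\<dots> = \<phi> z * \<phi> (x k)" using k by (intro mult z basis_integral)
    also have "\<dots> \<approx> \<phi> z * (\<Sum>j<n. c j * aut j (x k))"
      using k by (intro \<O>.cong_mod_mult_left closed z expansion basis_integral)
    also have "\<dots> = (\<Sum>j<n. conj_mat k j * (c j * \<phi> z))"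
      by (simp add: sum_distrib_left mult_ac)
    finally show "(\<Sum>j<n. conj_mat k j * (c j * (aut j z - \<phi> z))) \<approx> 0"
      by (simp add: right_diff_distrib sum_subtractf \<O>.cong_mod_diff_iff)
  qed (rule j)
  then show ?thesis
    unfolding right_diff_distrib \<O>.cong_mod_diff_iff by (rule \<O>.cong_mod_sym)
qed

lemma power_aut_combination:
  assumes power: "\<And>a. g dvd a ^ Q - a" and Q: "Q = CHAR('k) ^ m"
  obtains c where "\<And>j. j < n \<Longrightarrow> c j \<in> \<O>" "\<And>y. y \<in> \<O> \<Longrightarrow> y ^ Q \<approx> (\<Sum>j<n. c j * aut j y)"
proof (rule linear_map_aut_combination[of "\<lambda>y. y ^ Q"])
  show "x i ^ Q \<in> \<O>" if "i < n" for i using basis_integral[OF that] by blast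
  fix a
  have "(\<Sum>i<n. \<iota> (a i) * x i) ^ Q = (\<Sum>i<n. \<iota> (a i ^ Q) * x i ^ Q)"
    by (simp add: freshmans_dream_sum'[OF prime_CHAR Q] power_mult_distrib \<iota>.hom_power)
  also have "\<dots> \<approx> (\<Sum>i<n. \<iota> (a i) * x i ^ Q)"
    by (intro \<O>.cong_mod_sum \<O>.cong_mod_mult_right \<O>.power_closed basis_integral)
      (simp_all add: cong_mod_poly_emb_iff power)
  finally show "(\<Sum>i<n. \<iota> (a i) * x i) ^ Q \<approx> (\<Sum>i<n. \<iota> (a i) * x i ^ Q)" .
qed (rule that)

lemma coefficient_mult_aut_funpow:
  assumes "\<And>z. z \<in> \<O> \<Longrightarrow> c * z ^ Q \<approx> c * aut j z" "z \<in> \<O>"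
  shows "c * z ^ (Q ^ k) \<approx> c * (aut j ^^ k) z"
  using assms(2)
proof (induction k arbitrary: z)
  case (Suc k)
  have "c * (z ^ (Q ^ k)) ^ Q \<approx> c * aut j (z ^ (Q ^ k))"
    using Suc.prems by (intro assms(1) \<O>.power_closed)
  then have "c * z ^ (Q ^ Suc k) \<approx> c * (aut j z) ^ (Q ^ k)"
    by (simp add: power_mult[symmetric] mult.commute aut.hom_power)
  also have "\<dots> \<approx> c * (aut j ^^ k) (aut j z)"
    using Suc.prems by (intro Suc.IH aut_integral)
  finally show ?case by (simp add: funpow_swap1)
qed simp

theorem power_cong_self:
  assumes power: "\<And>a. g dvd a ^ Q - a" and Q: "Q = CHAR('k) ^ m" and z: "z \<in> \<O>"
  shows "z ^ (Q ^ n) \<approx> z"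
proof -
  obtain c where c: "\<And>j. j < n \<Longrightarrow> c j \<in> \<O>"
    and expansion: "\<And>y. y \<in> \<O> \<Longrightarrow> y ^ Q \<approx> (\<Sum>j<n. c j * aut j y)"
    using power_aut_combination[OF power Q] by blast
  have coefficient: "c j * y ^ Q \<approx> c j * aut j y" if "j < n" "y \<in> \<O>" for j y
    using that c expansion
    by (intro multiplicative_map_coefficient[of "\<lambda>y. y ^ Q"]) (auto simp: power_mult_distrib)
  have one: "1 \<approx> (\<Sum>j<n. c j)" using expansion[of 1] by simp
  have "z ^ (Q ^ n) = 1 * z ^ (Q ^ n)" by simp
  also have "\<dots> \<approx> (\<Sum>j<n. c j) * z ^ (Q ^ n)"
    using z one by (intro \<O>.cong_mod_mult_right \<O>.power_closed)
  also have "\<dots> = (\<Sum>j<n. c j * z ^ (Q ^ n))" by (rule sum_distrib_right)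
  also have "\<dots> \<approx> (\<Sum>j<n. c j * (aut j ^^ n) z)"
    using coefficient z by (intro \<O>.cong_mod_sum coefficient_mult_aut_funpow) auto
  also have "\<dots> = (\<Sum>j<n. c j) * z"
    by (simp add: funpow_degree_eq_id[OF aut_in_Gal] sum_distrib_right)
  also have "\<dots> \<approx> 1 * z" by (rule \<O>.cong_mod_mult_right[OF z \<O>.cong_mod_sym[OF one]])
  finally show ?thesis by simp
qed

end

theorem theorem5p1:
  fixes g :: "'f::{finite,field} poly"
    and emb :: "'f poly fract \<Rightarrow> 'k::field"
  assumes "carmichael_poly g"
    and "field_hom emb"
    and "galois_ext emb"
    and "rel_prime_ideal (discriminant_ideal emb) g"
  shows "carmichael_in emb (poly_emb emb g)"
proof -
  interpret galois_function_field emb by unfold_locales (use assms in auto)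
  let ?Q = "card (carrier (UNIV.quotient_by g))"
  have fin: "finite (carrier (UNIV.quotient_by g))" and not_field: "\<not> field (UNIV.quotient_by g)"
    and power: "\<And>a. g dvd a ^ ?Q - a"
    using assms(1) unfolding carmichael_poly_def poly_ring_def UNIV.carmichael_ideal_iff[OF UNIV_I]
    by (auto simp: cong_mod_UNIV_iff)
  obtain x where x: "integral_basis x" by (rule integral_basis_exists)
  obtain u v where "u * disc x + v * g = 1" by (rule disc_coprime_if_integral_basis[OF x assms(4)])
  with x interpret coprime_discriminant emb g x u v by unfold_locales
  obtain m where "?Q = CHAR('k) ^ m" by (rule card_poly_quotient_eq_CHAR_power[OF fin])
  then have "\<forall>z\<in>\<O>. z ^ (?Q ^ n) \<approx> z" using power_cong_self[OF power] by blast
  moreover have "\<not> field (\<O>.quotient_by (\<iota> g))"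
    using not_field field_poly_quotient_if_field_integral_quotient[OF fin] by blast
  ultimately show ?thesis
    unfolding carmichael_in_def O_ring_def \<O>.carmichael_ideal_iff[OF \<iota>.hom_integral]
    by (simp add: card_integral_quotient[OF fin])
qed

end
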